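(* Let $k$ be an algebraically closed field of characteristic $0$, let $n\ge 2$, and let $Q=\{r,\,p_{i,j}\}_{1\le i<j\le n}$ be nonzero elements of $k$ with $r\neq 1$; put $q_{i,j}=r/p_{i,j}$. Then the Hopf algebra $U(R_Q)$ is finite-dimensional over $k$ if and only if $r$ and each $q_{i,j}$ ($1\le i<j\le n$) is a root of unity.
   Context: Notation. For $1\le i,j\le n$ set $\kappa_j^i=p_{i,j}$ if $i<j$, $\kappa_j^i=r$ if $i=j$, and $\kappa_j^i=q_{j,i}=r/p_{j,i}$ if $i>j$. Let $V_0$ be a $k$-vector space with basis $v_1,\dots,v_n$ and let $R_Q:V_0\otimes V_0\to V_0\otimes V_0$ be the Yang-Baxter operator $R_Q(v_i\otimes v_j)=\sum_{k,l}R_{ij}^{kl}\,v_k\otimes v_l$, where $R_{ij}^{kl}=\kappa^i_j$ if $i=l,\ j=k$; $R_{ij}^{kl}=r-1$ if $i=k,\ j=l,\ i>j$; and $R_{ij}^{kl}=0$ otherwise. $A(R_Q)$ is the associated Faddeev-Reshetikhin-Takhtajan bialgebra: the $k$-algebra generated by $T_i^j$ ($1\le i,j\le n$) with relations $\sum_{k,l}R_{ij}^{kl}T_k^aT_l^b=\sum_{k,l}T_i^kT_j^lR_{kl}^{ab}$ for all $i,j,a,b$, with $\Delta(T_i^j)=\sum_k T_i^k\otimes T_k^j$ and $\varepsilon(T_i^j)=\delta_{ij}$. $A(R_Q)^0$ denotes the finite dual bialgebra (convolution product $(uu')(a)=\sum u(a_{(1)})u'(a_{(2)})$, coproduct determined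 by $u(ab)=\sum u_{(1)}(a)u_{(2)}(b)$). In it one has, for $1\le i\le n$, the group-like elements (algebra homomorphisms $A(R_Q)\to k$) $K_i(T_j^l)=\delta_{jl}\kappa_j^i$ and $L_i(T_j^l)=\delta_{jl}(\kappa_i^j)^{-1}$, which are convolution invertible, and for $1\le i\le n-1$ the elements $E_{i+1}^i$, $F_i^{i+1}$ determined by $E_{i+1}^i(T_k^l)=\delta_{k,i}\delta_{l,i+1}$, $F_i^{i+1}(T_k^l)=\delta_{k,i+1}\delta_{l,i}$ and $\Delta(E_{i+1}^i)=K_{i+1}\otimes E_{i+1}^i+E_{i+1}^i\otimes K_i$, $\Delta(F_i^{i+1})=L_i\otimes F_i^{i+1}+F_i^{i+1}\otimes L_{i+1}$. $U(R_Q)$ (also written $U_Q$) is the Hopf algebra which is the subalgebra of $A(R_Q)^0$ generated by all $K_i^{\pm1},L_i^{\pm1}$ ($1\le i\le n$) and $E_{i+1}^i,F_i^{i+1}$ ($1\le i\le n-1$). *)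

theory Defs
  imports
    "HOL-Library.Poly_Mapping"
    "HOL-Library.Product_Plus"
    "HOL-Library.Function_Algebras"
    "HOL-Computational_Algebra.Polynomial"
    "HOL-Algebra.QuotRing"
    "HOL-Algebra.Subrings"
begin

section \<open>Free algebras\<close>

text \<open>
  The free monoid on \<open>'a\<close>, written additively, so that \<open>'a word \<Rightarrow>\<^sub>0 'k\<close> with the
  (convolution) product of \<^theory>\<open>HOL-Library.Poly_Mapping\<close> is the free algebra on \<open>'a\<close>, and
  \<open>'a word \<times> 'a word \<Rightarrow>\<^sub>0 'k\<close> is the tensor square of that algebra.
\<close>

datatype 'a word = Word (letters: "'a list")

instantiation word :: (type) monoid_add
begin

definition zero_word :: "'a word" where
  "0 = Word []"

definition plus_word :: "'a word \<Rightarrow> 'a word \<Rightarrow> 'a word" where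
  "v + w = Word (letters v @ letters w)"

instance
  by standard (simp_all add: zero_word_def plus_word_def)

end

definition const :: "'k \<Rightarrow> ('m::monoid_add \<Rightarrow>\<^sub>0 'k::comm_ring_1)" where
  "const c = Poly_Mapping.single 0 c"

text \<open>
  The extension of a map \<open>f\<close> on letters to an algebra homomorphism on the free algebra, where
  \<open>\<iota>\<close> is the structure map from scalars into the target algebra.
\<close>

definition free_lift ::
  "('k::comm_ring_1 \<Rightarrow> 'b::ring_1) \<Rightarrow> ('a \<Rightarrow> 'b) \<Rightarrow> ('a word \<Rightarrow>\<^sub>0 'k) \<Rightarrow> 'b" where
  "free_lift \<iota> f x =
     (\<Sum>w\<in>Poly_Mapping.keys x. \<iota> (Poly_Mapping.lookup x w) * prod_list (map f (letters w)))"


section \<open>The Yang-Baxter operator and its bialgebra\<close>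

text \<open>
  The data \<open>Q\<close> are \<open>r\<close> and \<open>p i j\<close> for \<open>1 \<le> i < j \<le> n\<close>; other values of \<open>p\<close> are never used.
  \<open>kappa r p i j\<close> is the scalar with upper index \<open>i\<close> and lower index \<open>j\<close>, and
  \<open>Rcoeff r p i j k l\<close> is the coefficient of \<open>v\<^sub>k \<otimes> v\<^sub>l\<close> in the image of \<open>v\<^sub>i \<otimes> v\<^sub>j\<close>.
\<close>

definition kappa :: "'k::field \<Rightarrow> (nat \<Rightarrow> nat \<Rightarrow> 'k) \<Rightarrow> nat \<Rightarrow> nat \<Rightarrow> 'k" where
  "kappa r p i j = (if i < j then p i j else if i = j then r else r / p j i)"

definition Rcoeff ::
  "'k::field \<Rightarrow> (nat \<Rightarrow> nat \<Rightarrow> 'k) \<Rightarrow> nat \<Rightarrow> nat \<Rightarrow> nat \<Rightarrow> nat \<Rightarrow> 'k" where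
  "Rcoeff r p i j k l =
     (if i = l \<and> j = k then kappa r p i j
      else if i = k \<and> j = l \<and> i > j then r - 1
      else 0)"

text \<open>The letter \<open>(i, j)\<close> stands for the generator with lower index \<open>i\<close> and upper index \<open>j\<close>.\<close>

type_synonym 'k free = "(nat \<times> nat) word \<Rightarrow>\<^sub>0 'k"

definition Tgen :: "nat \<Rightarrow> nat \<Rightarrow> 'k::field free" where
  "Tgen i j = Poly_Mapping.single (Word [(i, j)]) 1"

definition free_ring :: "nat \<Rightarrow> 'k::field free ring" where
  "free_ring n =
     \<lparr>carrier = {x. \<forall>w\<in>Poly_Mapping.keys x. set (letters w) \<subseteq> {1..n} \<times> {1..n}},
      mult = (*), one = 1, zero = 0, add = (+)\<rparr>"

definition FRT_relations :: "nat \<Rightarrow> 'k::field \<Rightarrow> (nat \<Rightarrow> nat \<Rightarrow> 'k) \<Rightarrow> 'k free set" where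
  "FRT_relations n r p =
     {(\<Sum>k=1..n. \<Sum>l=1..n. const (Rcoeff r p i j k l) * (Tgen k a * Tgen l b))
        - (\<Sum>k=1..n. \<Sum>l=1..n. const (Rcoeff r p k l a b) * (Tgen i k * Tgen j l))
      | i j a b. i \<in> {1..n} \<and> j \<in> {1..n} \<and> a \<in> {1..n} \<and> b \<in> {1..n}}"

definition FRT_ideal :: "nat \<Rightarrow> 'k::field \<Rightarrow> (nat \<Rightarrow> nat \<Rightarrow> 'k) \<Rightarrow> 'k free set" where
  "FRT_ideal n r p = Idl\<^bsub>free_ring n\<^esub> (FRT_relations n r p)"

definition FRT :: "nat \<Rightarrow> 'k::field \<Rightarrow> (nat \<Rightarrow> nat \<Rightarrow> 'k) \<Rightarrow> 'k free set ring" where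
  "FRT n r p = free_ring n Quot FRT_ideal n r p"

definition FRT_proj :: "nat \<Rightarrow> 'k::field \<Rightarrow> (nat \<Rightarrow> nat \<Rightarrow> 'k) \<Rightarrow> 'k free \<Rightarrow> 'k free set" where
  "FRT_proj n r p x = FRT_ideal n r p +>\<^bsub>free_ring n\<^esub> x"

definition FRT_scale ::
  "nat \<Rightarrow> 'k::field \<Rightarrow> (nat \<Rightarrow> nat \<Rightarrow> 'k) \<Rightarrow> 'k \<Rightarrow> 'k free set \<Rightarrow> 'k free set" where
  "FRT_scale n r p c a = FRT_proj n r p (const c) \<otimes>\<^bsub>FRT n r p\<^esub> a"

text \<open>
  The coproduct and counit on the free algebra. They descend to the quotient because the defining
  ideal is a biideal, so below they are evaluated on an arbitrary representative of a coset.
\<close>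

definition free_comult ::
  "nat \<Rightarrow> 'k::field free \<Rightarrow> ((nat \<times> nat) word \<times> (nat \<times> nat) word \<Rightarrow>\<^sub>0 'k)" where
  "free_comult n =
     free_lift const (\<lambda>(i, j). \<Sum>k=1..n. Poly_Mapping.single (Word [(i, k)], Word [(k, j)]) 1)"

definition free_counit :: "'k::field free \<Rightarrow> 'k" where
  "free_counit = free_lift (\<lambda>c. c) (\<lambda>(i, j). if i = j then 1 else 0)"

definition coset_rep :: "'k::field free set \<Rightarrow> 'k free" where
  "coset_rep X = (SOME x. x \<in> X)"


section \<open>The finite dual\<close>

text \<open>
  A functional is a function on cosets that vanishes outside the carrier, so that functionals are
  determined by their values on the bialgebra.
\<close>

definition functionals ::
  "nat \<Rightarrow> 'k::field \<Rightarrow> (nat \<Rightarrow> nat \<Rightarrow> 'k) \<Rightarrow> ('k free set \<Rightarrow> 'k) set" where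
  "functionals n r p =
     {u. (\<forall>a\<in>carrier (FRT n r p). \<forall>b\<in>carrier (FRT n r p). u (a \<oplus>\<^bsub>FRT n r p\<^esub> b) = u a + u b)
       \<and> (\<forall>c. \<forall>a\<in>carrier (FRT n r p). u (FRT_scale n r p c a) = c * u a)
       \<and> (\<forall>a. a \<notin> carrier (FRT n r p) \<longrightarrow> u a = 0)}"

definition finite_codim ::
  "nat \<Rightarrow> 'k::field \<Rightarrow> (nat \<Rightarrow> nat \<Rightarrow> 'k) \<Rightarrow> 'k free set set \<Rightarrow> bool" where
  "finite_codim n r p J \<longleftrightarrow>
     (\<exists>S. finite S \<and> S \<subseteq> carrier (FRT n r p) \<and>
       (\<forall>a\<in>carrier (FRT n r p). \<exists>c.
          a \<ominus>\<^bsub>FRT n r p\<^esub> (\<Oplus>\<^bsub>FRT n r p\<^esub>s\<in>S. FRT_scale n r p (c s) s) \<in> J))"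

definition convolution ::
  "nat \<Rightarrow> 'k::field \<Rightarrow> (nat \<Rightarrow> nat \<Rightarrow> 'k) \<Rightarrow>
   ('k free set \<Rightarrow> 'k) \<Rightarrow> ('k free set \<Rightarrow> 'k) \<Rightarrow> 'k free set \<Rightarrow> 'k" where
  "convolution n r p u u' a =
     (if a \<in> carrier (FRT n r p)
      then let d = free_comult n (coset_rep a) in
        (\<Sum>(v, w)\<in>Poly_Mapping.keys d. Poly_Mapping.lookup d (v, w)
           * u (FRT_proj n r p (Poly_Mapping.single v 1))
           * u' (FRT_proj n r p (Poly_Mapping.single w 1)))
      else 0)"

definition FRT_counit ::
  "nat \<Rightarrow> 'k::field \<Rightarrow> (nat \<Rightarrow> nat \<Rightarrow> 'k) \<Rightarrow> 'k free set \<Rightarrow> 'k" where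
  "FRT_counit n r p a = (if a \<in> carrier (FRT n r p) then free_counit (coset_rep a) else 0)"

definition finite_dual ::
  "nat \<Rightarrow> 'k::field \<Rightarrow> (nat \<Rightarrow> nat \<Rightarrow> 'k) \<Rightarrow> ('k free set \<Rightarrow> 'k) ring" where
  "finite_dual n r p =
     \<lparr>carrier = {u \<in> functionals n r p.
         \<exists>J. ideal J (FRT n r p) \<and> finite_codim n r p J \<and> (\<forall>a\<in>J. u a = 0)},
      mult = convolution n r p, one = FRT_counit n r p, zero = 0, add = (+)\<rparr>"


section \<open>The Hopf algebra generated by the K, L, E and F\<close>

definition Tcls :: "nat \<Rightarrow> 'k::field \<Rightarrow> (nat \<Rightarrow> nat \<Rightarrow> 'k) \<Rightarrow> nat \<Rightarrow> nat \<Rightarrow> 'k free set" where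
  "Tcls n r p i j = FRT_proj n r p (Tgen i j)"

definition grouplike ::
  "nat \<Rightarrow> 'k::field \<Rightarrow> (nat \<Rightarrow> nat \<Rightarrow> 'k) \<Rightarrow> ('k free set \<Rightarrow> 'k) \<Rightarrow> bool" where
  "grouplike n r p u \<longleftrightarrow> u \<in> carrier (finite_dual n r p)
     \<and> u \<one>\<^bsub>FRT n r p\<^esub> = 1
     \<and> (\<forall>a\<in>carrier (FRT n r p). \<forall>b\<in>carrier (FRT n r p). u (a \<otimes>\<^bsub>FRT n r p\<^esub> b) = u a * u b)"

text \<open>
  \<open>skew_primitive n r p g h u\<close> says that the coproduct of \<open>u\<close> in the finite dual is
  \<open>g \<otimes> u + u \<otimes> h\<close>, the coproduct being dual to the multiplication.
\<close>

definition skew_primitive ::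
  "nat \<Rightarrow> 'k::field \<Rightarrow> (nat \<Rightarrow> nat \<Rightarrow> 'k) \<Rightarrow>
   ('k free set \<Rightarrow> 'k) \<Rightarrow> ('k free set \<Rightarrow> 'k) \<Rightarrow> ('k free set \<Rightarrow> 'k) \<Rightarrow> bool" where
  "skew_primitive n r p g h u \<longleftrightarrow> u \<in> carrier (finite_dual n r p)
     \<and> (\<forall>a\<in>carrier (FRT n r p). \<forall>b\<in>carrier (FRT n r p).
          u (a \<otimes>\<^bsub>FRT n r p\<^esub> b) = g a * u b + u a * h b)"

definition Kelt ::
  "nat \<Rightarrow> 'k::field \<Rightarrow> (nat \<Rightarrow> nat \<Rightarrow> 'k) \<Rightarrow> nat \<Rightarrow> 'k free set \<Rightarrow> 'k" where
  "Kelt n r p i = (THE u. grouplike n r p u \<and>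
     (\<forall>j\<in>{1..n}. \<forall>l\<in>{1..n}. u (Tcls n r p j l) = (if j = l then kappa r p i j else 0)))"

definition Lelt ::
  "nat \<Rightarrow> 'k::field \<Rightarrow> (nat \<Rightarrow> nat \<Rightarrow> 'k) \<Rightarrow> nat \<Rightarrow> 'k free set \<Rightarrow> 'k" where
  "Lelt n r p i = (THE u. grouplike n r p u \<and>
     (\<forall>j\<in>{1..n}. \<forall>l\<in>{1..n}. u (Tcls n r p j l) = (if j = l then inverse (kappa r p j i) else 0)))"

text \<open>\<open>Eelt n r p i\<close> has lower index \<open>i + 1\<close> and upper index \<open>i\<close>; \<open>Felt n r p i\<close> vice versa.\<close>

definition Eelt ::
  "nat \<Rightarrow> 'k::field \<Rightarrow> (nat \<Rightarrow> nat \<Rightarrow> 'k) \<Rightarrow> nat \<Rightarrow> 'k free set \<Rightarrow> 'k" where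
  "Eelt n r p i = (THE u. skew_primitive n r p (Kelt n r p (i + 1)) (Kelt n r p i) u \<and>
     (\<forall>k\<in>{1..n}. \<forall>l\<in>{1..n}. u (Tcls n r p k l) = (if k = i \<and> l = i + 1 then 1 else 0)))"

definition Felt ::
  "nat \<Rightarrow> 'k::field \<Rightarrow> (nat \<Rightarrow> nat \<Rightarrow> 'k) \<Rightarrow> nat \<Rightarrow> 'k free set \<Rightarrow> 'k" where
  "Felt n r p i = (THE u. skew_primitive n r p (Lelt n r p i) (Lelt n r p (i + 1)) u \<and>
     (\<forall>k\<in>{1..n}. \<forall>l\<in>{1..n}. u (Tcls n r p k l) = (if k = i + 1 \<and> l = i then 1 else 0)))"

definition U_generators ::
  "nat \<Rightarrow> 'k::field \<Rightarrow> (nat \<Rightarrow> nat \<Rightarrow> 'k) \<Rightarrow> ('k free set \<Rightarrow> 'k) set" where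
  "U_generators n r p =
     Kelt n r p ` {1..n} \<union> (\<lambda>i. inv\<^bsub>finite_dual n r p\<^esub> Kelt n r p i) ` {1..n}
     \<union> Lelt n r p ` {1..n} \<union> (\<lambda>i. inv\<^bsub>finite_dual n r p\<^esub> Lelt n r p i) ` {1..n}
     \<union> Eelt n r p ` {1..<n} \<union> Felt n r p ` {1..<n}"

definition fun_scale :: "'k::field \<Rightarrow> ('a \<Rightarrow> 'k) \<Rightarrow> 'a \<Rightarrow> 'k" where
  "fun_scale c u = (\<lambda>a. c * u a)"

definition U_alg ::
  "nat \<Rightarrow> 'k::field \<Rightarrow> (nat \<Rightarrow> nat \<Rightarrow> 'k) \<Rightarrow> ('k free set \<Rightarrow> 'k) set" where
  "U_alg n r p =
     \<Inter>{V. subring V (finite_dual n r p) \<and> (\<forall>c. \<forall>u\<in>V. fun_scale c u \<in> V)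
         \<and> U_generators n r p \<subseteq> V}"

global_interpretation fun_space: vector_space "fun_scale :: 'k::field \<Rightarrow> ('a \<Rightarrow> 'k) \<Rightarrow> _"
  defines fun_span = fun_space.span
  by standard (auto simp: fun_scale_def fun_eq_iff algebra_simps)

definition finite_dimensional :: "('a \<Rightarrow> 'k::field) set \<Rightarrow> bool" where
  "finite_dimensional V \<longleftrightarrow> (\<exists>B. finite B \<and> V = fun_span B)"

definition is_root_of_unity :: "'k::field \<Rightarrow> bool" where
  "is_root_of_unity x \<longleftrightarrow> (\<exists>m>0. x ^ m = 1)"

end

theory Submission
  imports Defs
begin

text \<open>
  Throughout, a functional on the bialgebra is studied through its values on words in the
  generators \<open>T i j\<close>: it is a linear form on the free algebra that kills the defining ideal.
  Since the coproduct of a word is \<open>\<Sum>\<^sub>k (i, k) \<otimes> (k, j)\<close> over multi-indices \<open>k\<close>, convolution is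
  multiplication of matrices whose rows and columns are indexed by multi-indices. In this picture
  the elements \<open>K\<close>, \<open>L\<close> are the diagonal characters \<open>chi\<close>, and \<open>E\<close>, \<open>F\<close> are the functions \<open>skew\<close>.

  Finite dimension forces roots of unity (\<open>finite_dimensional_imp_kappa_root\<close>): the \<open>m\<close>-th power of
  \<open>K i\<close> takes the value \<open>(\<kappa>\<^sup>m)\<^sup>d\<close> on the \<open>d\<close>-th power of \<open>T j j\<close>, where \<open>\<kappa> = kappa r p i j\<close>. If \<open>\<kappa>\<close> is
  not a root of unity, the numbers \<open>\<kappa>\<^sup>m\<close> are distinct, and a Vandermonde argument shows that all the
  powers of \<open>K i\<close> are linearly independent. The scalars \<open>r\<close> and \<open>q i j\<close> are among the \<open>\<kappa>\<close>.

  For the converse, let \<open>l \<ge> 2\<close> be the order of \<open>r\<close> and let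
  \<open>N\<close> be a common exponent of all the \<open>\<kappa>\<close>; then \<open>l\<close> divides \<open>N\<close>. Consider the ideal generated by the
  FRT relations together with all \<open>(T i j)\<^sup>l\<close> for \<open>i \<noteq> j\<close> and all \<open>(T i i)\<^sup>N - 1\<close> (\<open>power_ideal\<close>).

  \<^item> It is a coideal (\<open>power_ideal_coideal\<close>). The summands \<open>T i k \<otimes> T k j\<close> of the coproduct of
    \<open>T i j\<close> commute with one another up to the factor \<open>r\<close>, so the q-binomial theorem at the root of
    unity \<open>r\<close> gives \<open>\<Delta> ((T i j)\<^sup>l) = \<Sum>\<^sub>k (T i k)\<^sup>l \<otimes> (T k j)\<^sup>l\<close>. Modulo the ideal only \<open>i = k = j\<close> survives.
  \<^item> It has finite codimension (\<open>finite_spanning_words\<close>), because the relations allow one to sort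
    words, and a long sorted word contains an \<open>N\<close>-th power of a generator.
  \<^item> The generators of the Hopf algebra vanish on it (\<open>U_generators_vanishing\<close>): for \<open>K\<close> and \<open>L\<close>
    because their values are \<open>N\<close>-th roots of unity, for \<open>E\<close> and \<open>F\<close> because a skew-primitive
    element kills \<open>(T i j)\<^sup>l\<close> as soon as \<open>l \<ge> 2\<close>; this is where \<open>r \<noteq> 1\<close> enters.

  Functionals vanishing on a coideal which is an ideal of finite codimension form a
  finite-dimensional algebra under convolution, and this algebra contains \<open>U_alg n r p\<close>.
\<close>
section \<open>Linear extension of functions on a monoid\<close>

definition lin_ext :: "('m \<Rightarrow> 'k) \<Rightarrow> ('m \<Rightarrow>\<^sub>0 'k::comm_ring_1) \<Rightarrow> 'k" where
  "lin_ext \<phi> x = (\<Sum>w\<in>Poly_Mapping.keys x. Poly_Mapping.lookup x w * \<phi> w)"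

definition tens :: "('a \<Rightarrow> 'k) \<Rightarrow> ('b \<Rightarrow> 'k) \<Rightarrow> 'a \<times> 'b \<Rightarrow> 'k::comm_ring_1" where
  "tens \<phi> \<psi> = (\<lambda>(v, w). \<phi> v * \<psi> w)"

lemma lin_ext_superset:
  assumes "finite A" "Poly_Mapping.keys x \<subseteq> A"
  shows "lin_ext \<phi> x = (\<Sum>w\<in>A. Poly_Mapping.lookup x w * \<phi> w)"
  unfolding lin_ext_def
  by (rule sum.mono_neutral_left) (use assms in \<open>auto simp: in_keys_iff\<close>)

lemma lin_ext_0 [simp]: "lin_ext \<phi> 0 = 0"
  by (simp add: lin_ext_def)

lemma lin_ext_add: "lin_ext \<phi> (x + y) = lin_ext \<phi> x + lin_ext \<phi> y"
proof -
  let ?A = "Poly_Mapping.keys x \<union> Poly_Mapping.keys y"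
  have "lin_ext \<phi> z = (\<Sum>w\<in>?A. Poly_Mapping.lookup z w * \<phi> w)" if "z \<in> {x, y, x + y}" for z
    by (rule lin_ext_superset) (use that keys_add[of x y] in auto)
  then show ?thesis
    by (simp add: lookup_add distrib_right sum.distrib)
qed

lemma lin_ext_uminus: "lin_ext \<phi> (- x) = - lin_ext \<phi> x"
  using lin_ext_add[of \<phi> x "- x"] by (simp add: eq_neg_iff_add_eq_0 add.commute)

lemma lin_ext_diff: "lin_ext \<phi> (x - y) = lin_ext \<phi> x - lin_ext \<phi> y"
  using lin_ext_add[of \<phi> x "- y"] by (simp add: lin_ext_uminus)

lemma lin_ext_sum: "lin_ext \<phi> (\<Sum>i\<in>A. f i) = (\<Sum>i\<in>A. lin_ext \<phi> (f i))"
  by (induction A rule: infinite_finite_induct) (auto simp: lin_ext_add)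

lemma lin_ext_single [simp]: "lin_ext \<phi> (Poly_Mapping.single w c) = c * \<phi> w"
  by (cases "c = 0") (auto simp: lin_ext_def)

lemma lin_ext_zero_fun [simp]: "lin_ext (\<lambda>_. 0) x = 0"
  by (simp add: lin_ext_def)

lemma lin_ext_one [simp]: "lin_ext \<phi> (1 :: 'm::monoid_add \<Rightarrow>\<^sub>0 'k::comm_ring_1) = \<phi> 0"
  by (metis lin_ext_single mult_1 single_one)

lemma sum_monomials:
  fixes x :: "'m \<Rightarrow>\<^sub>0 'k::comm_ring_1"
  shows "x = (\<Sum>w\<in>Poly_Mapping.keys x. Poly_Mapping.single w (Poly_Mapping.lookup x w))"
proof (rule poly_mapping_eqI)
  fix v
  have "(\<Sum>w\<in>Poly_Mapping.keys x. Poly_Mapping.lookup (Poly_Mapping.single w (Poly_Mapping.lookup x w)) v)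
        = (\<Sum>w\<in>Poly_Mapping.keys x. if w = v then Poly_Mapping.lookup x v else 0)"
    by (rule sum.cong) (auto simp: lookup_single when_def)
  then show "Poly_Mapping.lookup x v = Poly_Mapping.lookup
      (\<Sum>w\<in>Poly_Mapping.keys x. Poly_Mapping.single w (Poly_Mapping.lookup x w)) v"
    by (auto simp: lookup_sum in_keys_iff)
qed

lemma monomial_induct [case_names keys zero add single]:
  fixes x :: "'m \<Rightarrow>\<^sub>0 'k::comm_ring_1"
  assumes k: "Poly_Mapping.keys x \<subseteq> A" and z: "P 0"
    and a: "\<And>x y. P x \<Longrightarrow> P y \<Longrightarrow> P (x + y)"
    and s: "\<And>w c. w \<in> A \<Longrightarrow> P (Poly_Mapping.single w c)"
  shows "P x"
proof -
  have "P (\<Sum>w\<in>B. Poly_Mapping.single w (Poly_Mapping.lookup x w))" if "finite B" "B \<subseteq> A" for B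
    using that by (induction B) (auto intro: z a s)
  from this[OF finite_keys k] show ?thesis
    using sum_monomials[of x] by simp
qed

lemma lin_ext_single_mult:
  fixes x :: "'m::monoid_add \<Rightarrow>\<^sub>0 'k::comm_ring_1"
  shows "lin_ext \<phi> (Poly_Mapping.single v c * x) = c * lin_ext (\<lambda>w. \<phi> (v + w)) x"
  by (induction x rule: monomial_induct[where A = UNIV])
    (auto simp: distrib_left lin_ext_add mult_single mult.assoc)

lemma lin_ext_mult_single:
  fixes x :: "'m::monoid_add \<Rightarrow>\<^sub>0 'k::comm_ring_1"
  shows "lin_ext \<phi> (x * Poly_Mapping.single v c) = c * lin_ext (\<lambda>w. \<phi> (w + v)) x"
  by (induction x rule: monomial_induct[where A = UNIV])
    (auto simp: distrib_left distrib_right lin_ext_add mult_single mult_ac)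

lemma const_commute:
  fixes x :: "'m::monoid_add \<Rightarrow>\<^sub>0 'k::comm_ring_1"
  shows "const c * x = x * const c"
  by (induction x rule: monomial_induct[where A = UNIV])
    (auto simp: distrib_left distrib_right const_def mult_single mult_ac)

lemma lin_ext_const_mult: "lin_ext \<phi> (const c * x) = c * lin_ext \<phi> x"
  by (simp add: const_def lin_ext_single_mult)

lemma const_mult_single: "const c * Poly_Mapping.single w d = Poly_Mapping.single w (c * d)"
  by (simp add: const_def mult_single)

lemma const_add: "const (c + d) = const c + const d"
  by (simp add: const_def single_add)

lemma const_mult: "const (c * d) = const c * const d"
  by (simp add: const_def mult_single)

lemma const_0 [simp]: "const 0 = 0" by (simp add: const_def)
lemma const_1 [simp]: "const 1 = 1" by (simp add: const_def)
section \<open>The q-binomial theorem modulo an ideal\<close>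

text \<open>
  The computations in the tensor square below hold only modulo an ideal, and the ambient ring is a
  type. Working with the congruence \<open>eqv\<close> avoids passing to a quotient type.
\<close>

locale two_sided_ideal =
  fixes B :: "'b::ring_1 set"
  assumes zero_mem: "0 \<in> B"
    and add_mem: "x \<in> B \<Longrightarrow> y \<in> B \<Longrightarrow> x + y \<in> B"
    and mult_left_mem: "x \<in> B \<Longrightarrow> s * x \<in> B"
    and mult_right_mem: "x \<in> B \<Longrightarrow> x * s \<in> B"
begin

definition eqv :: "'b \<Rightarrow> 'b \<Rightarrow> bool" where "eqv x y \<longleftrightarrow> x - y \<in> B"

lemma eqv_refl [simp]: "eqv x x"
  by (simp add: eqv_def zero_mem)

lemma eqv_trans [trans]: "eqv x y \<Longrightarrow> eqv y z \<Longrightarrow> eqv x z"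
  unfolding eqv_def using add_mem[of "x - y" "y - z"] by simp

lemma eqv_add: "eqv x y \<Longrightarrow> eqv x' y' \<Longrightarrow> eqv (x + x') (y + y')"
  unfolding eqv_def using add_mem[of "x - y" "x' - y'"] by (simp add: algebra_simps)

lemma eqv_mult:
  assumes "eqv x y" "eqv x' y'" shows "eqv (x * x') (y * y')"
proof -
  have "x * x' - y * y' = (x - y) * x' + y * (x' - y')"
    by (simp add: algebra_simps)
  then show ?thesis
    using assms add_mem mult_left_mem mult_right_mem unfolding eqv_def by metis
qed

lemma eqv_power: "eqv x y \<Longrightarrow> eqv (x ^ k) (y ^ k)"
  by (induction k) (auto intro: eqv_mult)

lemma eqv_sum: "(\<And>i. i \<in> A \<Longrightarrow> eqv (f i) (g i)) \<Longrightarrow> eqv (sum f A) (sum g A)"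
  by (induction A rule: infinite_finite_induct) (auto intro: eqv_add)

lemma eqv_0_iff: "eqv x 0 \<longleftrightarrow> x \<in> B"
  by (simp add: eqv_def)

end

text \<open>
  The coefficients of \<open>(x + y)\<^sup>m\<close> on the ordered monomials \<open>x\<^sup>k y\<^sup>m\<^sup>-\<^sup>k\<close> when \<open>y x = q x y\<close>: multiplying by
  \<open>x\<close> from the right costs one factor \<open>q\<close> for each of the \<open>m - k\<close> letters \<open>y\<close> that it passes.
\<close>

fun gauss_binomial :: "'k::comm_ring_1 \<Rightarrow> nat \<Rightarrow> nat \<Rightarrow> 'k" where
  "gauss_binomial q m 0 = 1"
| "gauss_binomial q 0 (Suc k) = 0"
| "gauss_binomial q (Suc m) (Suc k) = gauss_binomial q m (Suc k) + q ^ (m - k) * gauss_binomial q m k"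

lemma gauss_binomial_eq_0: "m < k \<Longrightarrow> gauss_binomial q m k = 0"
  by (induction q m k rule: gauss_binomial.induct) auto

lemma gauss_binomial_self [simp]: "gauss_binomial q m m = 1"
  by (induction m) (auto simp: gauss_binomial_eq_0)

text \<open>
  The division-free form of the product formula for Gaussian binomials. It remains meaningful when
  \<open>q\<close> is a root of unity, where the quotient of q-factorials is undefined.
\<close>

lemma gauss_binomial_recurrence:
  "(1 - q ^ Suc k) * gauss_binomial q m (Suc k) = (1 - q ^ (m - k)) * gauss_binomial q m k"
proof (induction m arbitrary: k)
  case 0
  then show ?case by simp
next
  case (Suc m)
  consider "k \<ge> m + 1" | "k = 0" | k' where "k = Suc k'" "k \<le> m"
    by (cases k) force+
  then show ?case
  proof cases
    case 1
    then show ?thesis by (auto simp: gauss_binomial_eq_0)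
  next
    case 2
    have "(1 - q) * (gauss_binomial q m (Suc 0) + q ^ m) = 1 - q ^ m + (1 - q) * q ^ m"
      using Suc.IH[of 0] by (simp add: distrib_left)
    also have "\<dots> = 1 - q * q ^ m" by (simp add: algebra_simps)
    finally show ?thesis using 2 by simp
  next
    case 3
    define c where "c = gauss_binomial q m k"
    define c' where "c' = gauss_binomial q m k'"
    define c'' where "c'' = gauss_binomial q m (Suc k)"
    have 1: "(1 - q ^ Suc k) * c'' = (1 - q ^ (m - k)) * c"
      using Suc.IH[of k] by (simp add: c_def c''_def)
    have 2: "(1 - q ^ k) * c = (1 - q ^ (m - k')) * c'"
      using Suc.IH[of k'] 3 by (simp add: c_def c'_def)
    have p: "q ^ Suc k * q ^ (m - k) = q ^ Suc m" "q ^ (m - k') * q ^ k = q ^ Suc m"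
      using 3 by (simp_all flip: power_add power_Suc)
    have "(1 - q ^ Suc k) * gauss_binomial q (Suc m) (Suc k)
        = (1 - q ^ Suc k) * c'' + (1 - q ^ Suc k) * q ^ (m - k) * c"
      using 3 by (simp add: c''_def c_def c'_def algebra_simps)
    also have "\<dots> = (1 - q ^ (m - k)) * c + (q ^ (m - k) - q ^ Suc k * q ^ (m - k)) * c"
      unfolding 1 by (simp add: left_diff_distrib)
    also have "\<dots> = (1 - q ^ (m - k')) * c + (q ^ (m - k') - q ^ (m - k') * q ^ k) * c"
      unfolding p by (simp add: algebra_simps)
    also have "\<dots> = (1 - q ^ (m - k')) * c + q ^ (m - k') * ((1 - q ^ k) * c)"
      by (simp add: algebra_simps)
    also have "\<dots> = (1 - q ^ (m - k')) * (c + q ^ (m - k') * c')"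
      unfolding 2 by (simp only: distrib_left mult.left_commute mult.assoc)
    also have "\<dots> = (1 - q ^ (Suc m - k)) * gauss_binomial q (Suc m) k"
      using 3 by (simp add: c_def c'_def)
    finally show ?thesis .
  qed
qed

text \<open>
  By the recurrence, each coefficient is a multiple of the preceding one divided by \<open>1 - q\<^sup>k\<^sup>+\<^sup>1\<close>, which
  is nonzero below the order of \<open>q\<close>; the chain starts with the factor \<open>1 - q\<^sup>l = 0\<close>.
\<close>

lemma gauss_binomial_root_of_unity:
  fixes q :: "'k::field"
  assumes "q ^ l = 1" "\<And>m. 0 < m \<Longrightarrow> m < l \<Longrightarrow> q ^ m \<noteq> 1" "0 < k" "k < l"
  shows "gauss_binomial q l k = 0"
  using assms(3,4)
proof (induction k rule: nat_induct_non_zero)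
  case 1
  then show ?case
    using gauss_binomial_recurrence[of q 0 l] assms(1) assms(2)[of 1] by auto
next
  case (Suc k)
  then show ?case
    using gauss_binomial_recurrence[of q k l] assms(2)[of "Suc k"] by auto
qed

context two_sided_ideal
begin

lemma eqv_pow_commute:
  assumes "eqv (y * x) (q * (x * y))" "\<And>z. q * z = z * q"
  shows "eqv (y ^ m * x) (q ^ m * (x * y ^ m))"
proof (induction m)
  case (Suc m)
  have "y ^ Suc m * x = y * (y ^ m * x)" by (simp add: mult.assoc)
  also have "eqv \<dots> (y * (q ^ m * (x * y ^ m)))"
    by (intro eqv_mult Suc eqv_refl)
  also have "y * (q ^ m * (x * y ^ m)) = q ^ m * (y * x * y ^ m)"
    using power_commuting_commutes[OF assms(2)[of y]] by (simp add: mult.assoc[symmetric])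
  also have "eqv \<dots> (q ^ m * (q * (x * y) * y ^ m))"
    by (intro eqv_mult assms eqv_refl)
  also have "q ^ m * (q * (x * y) * y ^ m) = q ^ Suc m * (x * y ^ Suc m)"
    by (simp only: power_Suc2[of q] power_Suc[of y] mult.assoc)
  finally show ?case .
qed auto

lemma q_binomial:
  fixes \<iota> :: "'k::comm_ring_1 \<Rightarrow> 'b"
  assumes hom: "\<And>c d. \<iota> (c + d) = \<iota> c + \<iota> d" "\<And>c d. \<iota> (c * d) = \<iota> c * \<iota> d" "\<iota> 1 = 1" "\<iota> 0 = 0"
    and central: "\<And>c z. \<iota> c * z = z * \<iota> c"
    and comm: "eqv (y * x) (\<iota> q * (x * y))"
  shows "eqv ((x + y) ^ m) (\<Sum>k\<le>m. \<iota> (gauss_binomial q m k) * (x ^ k * y ^ (m - k)))"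
proof (induction m)
  case 0
  then show ?case by (simp add: hom)
next
  case (Suc m)
  have pow: "\<iota> (c ^ k) = \<iota> c ^ k" for c k by (induction k) (auto simp: hom)
  let ?c = "gauss_binomial q"
  have "(x + y) ^ Suc m = (x + y) ^ m * (x + y)" by (simp add: power_commutes)
  also have "eqv \<dots> ((\<Sum>k\<le>m. \<iota> (?c m k) * (x ^ k * y ^ (m - k))) * (x + y))"
    by (intro eqv_mult Suc eqv_refl)
  also have "(\<Sum>k\<le>m. \<iota> (?c m k) * (x ^ k * y ^ (m - k))) * (x + y)
      = (\<Sum>k\<le>m. \<iota> (?c m k) * x ^ k * (y ^ (m - k) * x)) + (\<Sum>k\<le>m. \<iota> (?c m k) * (x ^ k * y ^ (Suc m - k)))"
    by (simp add: distrib_left sum_distrib_right mult.assoc Suc_diff_le power_commutes)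
  also have "eqv \<dots> ((\<Sum>k\<le>m. \<iota> (?c m k) * x ^ k * (\<iota> q ^ (m - k) * (x * y ^ (m - k)))) + (\<Sum>k\<le>m. \<iota> (?c m k)
      * (x ^ k * y ^ (Suc m - k))))"
    by (intro eqv_add eqv_sum eqv_mult eqv_refl eqv_pow_commute comm central)
  also have "(\<Sum>k\<le>m. \<iota> (?c m k) * x ^ k * (\<iota> q ^ (m - k) * (x * y ^ (m - k))))
      = (\<Sum>k\<le>m. \<iota> (q ^ (m - k) * ?c m k) * (x ^ Suc k * y ^ (m - k)))"
  proof (rule sum.cong[OF refl])
    fix k
    have "\<iota> (?c m k) * x ^ k * (\<iota> q ^ (m - k) * (x * y ^ (m - k)))
        = \<iota> (?c m k) * (x ^ k * \<iota> (q ^ (m - k))) * (x * y ^ (m - k))"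
      by (simp add: pow mult.assoc)
    also have "\<dots> = \<iota> (?c m k) * (\<iota> (q ^ (m - k)) * x ^ k) * (x * y ^ (m - k))"
      by (simp only: central)
    also have "\<dots> = \<iota> (?c m k * q ^ (m - k)) * (x ^ k * x) * y ^ (m - k)"
      by (simp add: hom(2) mult.assoc)
    finally show "\<iota> (?c m k) * x ^ k * (\<iota> q ^ (m - k) * (x * y ^ (m - k)))
        = \<iota> (q ^ (m - k) * ?c m k) * (x ^ Suc k * y ^ (m - k))"
      by (simp only: power_Suc2 mult.assoc mult.commute[of "q ^ (m - k)"])
  qed
  also have "(\<Sum>k\<le>m. \<iota> (?c m k) * (x ^ k * y ^ (Suc m - k)))
      = y ^ Suc m + (\<Sum>k\<le>m. \<iota> (?c m (Suc k)) * (x ^ Suc k * y ^ (m - k)))"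
  proof -
    have "(\<Sum>k\<le>m. \<iota> (?c m k) * (x ^ k * y ^ (Suc m - k))) = (\<Sum>k\<le>Suc m. \<iota> (?c m k) * (x ^ k * y ^ (Suc m - k)))"
      by (simp add: gauss_binomial_eq_0 hom)
    also have "\<dots> = y ^ Suc m + (\<Sum>k\<le>m. \<iota> (?c m (Suc k)) * (x ^ Suc k * y ^ (m - k)))"
      by (subst sum.atMost_Suc_shift) (simp add: hom)
    finally show ?thesis .
  qed
  also have "(\<Sum>k\<le>m. \<iota> (q ^ (m - k) * ?c m k) * (x ^ Suc k * y ^ (m - k))) + (y ^ Suc m + (\<Sum>k\<le>m. \<iota> (?c m
      (Suc k)) * (x ^ Suc k * y ^ (m - k))))
     = (\<Sum>k\<le>Suc m. \<iota> (?c (Suc m) k) * (x ^ k * y ^ (Suc m - k)))"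
    unfolding sum.atMost_Suc_shift by (simp add: hom sum.distrib algebra_simps)
  finally show ?case .
qed

lemma q_frobenius:
  fixes \<iota> :: "'k::field \<Rightarrow> 'b"
  assumes hom: "\<And>c d. \<iota> (c + d) = \<iota> c + \<iota> d" "\<And>c d. \<iota> (c * d) = \<iota> c * \<iota> d" "\<iota> 1 = 1" "\<iota> 0 = 0"
    and central: "\<And>c z. \<iota> c * z = z * \<iota> c"
    and comm: "eqv (y * x) (\<iota> q * (x * y))"
    and q: "0 < l" "q ^ l = 1" "\<And>m. 0 < m \<Longrightarrow> m < l \<Longrightarrow> q ^ m \<noteq> 1"
  shows "eqv ((x + y) ^ l) (x ^ l + y ^ l)"
proof -
  have "eqv ((x + y) ^ l) (\<Sum>k\<le>l. \<iota> (gauss_binomial q l k) * (x ^ k * y ^ (l - k)))"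
    by (rule q_binomial[OF hom central comm])
  also have "(\<Sum>k\<le>l. \<iota> (gauss_binomial q l k) * (x ^ k * y ^ (l - k)))
     = (\<Sum>k\<in>{0, l}. \<iota> (gauss_binomial q l k) * (x ^ k * y ^ (l - k)))"
    by (rule sum.mono_neutral_right) (auto simp: gauss_binomial_root_of_unity[OF q(2,3)] hom)
  also have "\<dots> = x ^ l + y ^ l"
    using q(1) by (simp add: hom add.commute)
  finally show ?thesis .
qed

text \<open>
  The partial sums \<open>x\<^sub>1 + \<dots> + x\<^sub>n\<close> again q-commute with \<open>x\<^sub>n\<^sub>+\<^sub>1\<close>, so the two-term case can be
  iterated.
\<close>

lemma q_frobenius_sum:
  fixes \<iota> :: "'k::field \<Rightarrow> 'b" and n :: nat
  assumes hom: "\<And>c d. \<iota> (c + d) = \<iota> c + \<iota> d" "\<And>c d. \<iota> (c * d) = \<iota> c * \<iota> d" "\<iota> 1 = 1" "\<iota> 0 = 0"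
    and central: "\<And>c z. \<iota> c * z = z * \<iota> c"
    and comm: "\<And>k m. 1 \<le> k \<Longrightarrow> k < m \<Longrightarrow> m \<le> n \<Longrightarrow> eqv (x m * x k) (\<iota> q * (x k * x m))"
    and q: "0 < l" "q ^ l = 1" "\<And>m. 0 < m \<Longrightarrow> m < l \<Longrightarrow> q ^ m \<noteq> 1"
  shows "eqv ((\<Sum>k=1..n. x k) ^ l) (\<Sum>k=1..n. x k ^ l)"
  using comm
proof (induction n)
  case 0
  then show ?case using q(1) by (simp add: zero_power)
next
  case (Suc n)
  have "eqv (x (Suc n) * (\<Sum>k=1..n. x k)) (\<iota> q * ((\<Sum>k=1..n. x k) * x (Suc n)))"
    unfolding sum_distrib_left sum_distrib_right
    by (rule eqv_sum) (use Suc.prems in auto)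
  then have "eqv (((\<Sum>k=1..n. x k) + x (Suc n)) ^ l) ((\<Sum>k=1..n. x k) ^ l + x (Suc n) ^ l)"
    by (intro q_frobenius[where \<iota> = \<iota> and q = q] hom central q)
  also have "eqv \<dots> ((\<Sum>k=1..n. x k ^ l) + x (Suc n) ^ l)"
    by (intro eqv_add Suc eqv_refl) (use Suc.prems in auto)
  finally show ?case by simp
qed

end

section \<open>Ideals of the free algebra and the coproduct\<close>

definition nwords :: "nat \<Rightarrow> (nat \<times> nat) word set" where
  "nwords n = {w. set (letters w) \<subseteq> {1..n} \<times> {1..n}}"

lemma letters_zero [simp]: "letters 0 = []" by (simp add: zero_word_def)
lemma letters_plus [simp]: "letters (v + w) = letters v @ letters w" by (simp add: plus_word_def)

lemma Word_Cons: "Word (x # w) = Word [x] + Word w" by (simp add: plus_word_def)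
lemma Word_plus: "Word v + Word w = Word (v @ w)" by (simp add: plus_word_def)
lemma Word_Nil: "Word [] = 0" by (simp add: zero_word_def)

lemma nwords_plus [simp]: "v + w \<in> nwords n \<longleftrightarrow> v \<in> nwords n \<and> w \<in> nwords n"
  by (auto simp: nwords_def)

lemma nwords_zero [simp]: "0 \<in> nwords n" by (simp add: nwords_def)

lemma nwords_Cons [simp]: "Word ((i, j) # w) \<in> nwords n \<longleftrightarrow> i \<in> {1..n} \<and> j \<in> {1..n} \<and> Word w \<in> nwords n"
  by (auto simp: nwords_def)

lemma nwords_Nil [simp]: "Word [] \<in> nwords n" by (simp add: nwords_def)

lemma carrier_free_ring: "carrier (free_ring n) = {x. Poly_Mapping.keys x \<subseteq> nwords n}"
  by (auto simp: free_ring_def nwords_def)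

lemma free_ring_simps [simp]:
  "x \<oplus>\<^bsub>free_ring n\<^esub> y = x + y" "x \<otimes>\<^bsub>free_ring n\<^esub> y = x * y"
  "\<one>\<^bsub>free_ring n\<^esub> = 1" "\<zero>\<^bsub>free_ring n\<^esub> = 0"
  by (simp_all add: free_ring_def)

lemma keys_uminus: "Poly_Mapping.keys (- x :: 'a \<Rightarrow>\<^sub>0 'b::ab_group_add) = Poly_Mapping.keys x"
  by (auto simp: in_keys_iff)

lemma free_carrier_0 [simp]: "0 \<in> carrier (free_ring n)"
  by (simp add: carrier_free_ring)

lemma free_carrier_1 [simp]: "1 \<in> carrier (free_ring n)"
  by (simp add: carrier_free_ring)

lemma free_carrier_add: "x \<in> carrier (free_ring n) \<Longrightarrow> y \<in> carrier (free_ring n) \<Longrightarrow> x + y \<in> carrier (free_ring n)"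
  using keys_add[of x y] by (auto simp: carrier_free_ring)

lemma free_carrier_uminus: "x \<in> carrier (free_ring n) \<Longrightarrow> - x \<in> carrier (free_ring n)"
  by (simp add: carrier_free_ring keys_uminus)

lemma free_carrier_diff: "x \<in> carrier (free_ring n) \<Longrightarrow> y \<in> carrier (free_ring n) \<Longrightarrow> x - y \<in> carrier (free_ring n)"
  using free_carrier_add[of x n "- y"] free_carrier_uminus[of y n] by simp

lemma free_carrier_mult: "x \<in> carrier (free_ring n) \<Longrightarrow> y \<in> carrier (free_ring n) \<Longrightarrow> x * y \<in> carrier (free_ring n)"
  using keys_mult[of x y] by (fastforce simp: carrier_free_ring)

lemma free_carrier_single: "w \<in> nwords n \<Longrightarrow> Poly_Mapping.single w c \<in> carrier (free_ring n)"
  by (simp add: carrier_free_ring)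

lemma free_carrier_const [simp]: "const c \<in> carrier (free_ring n)"
  unfolding const_def by (rule free_carrier_single) simp

lemma free_carrier_sum: "(\<And>i. i \<in> A \<Longrightarrow> f i \<in> carrier (free_ring n)) \<Longrightarrow> sum f A \<in> carrier (free_ring n)"
  by (induction A rule: infinite_finite_induct) (auto intro: free_carrier_add)

lemma free_carrier_Tgen: "i \<in> {1..n} \<Longrightarrow> j \<in> {1..n} \<Longrightarrow> Tgen i j \<in> carrier (free_ring n)"
  unfolding Tgen_def by (rule free_carrier_single) (simp add: Word_Nil)

lemma free_carrier_power: "x \<in> carrier (free_ring n) \<Longrightarrow> x ^ m \<in> carrier (free_ring n)"
  by (induction m) (auto intro: free_carrier_mult)

lemma ring_free_ring: "ring (free_ring n :: 'k::field free ring)"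
proof (rule ringI)
  show "abelian_group (free_ring n :: 'k free ring)"
  proof (rule abelian_groupI)
    show "\<exists>y\<in>carrier (free_ring n). y \<oplus>\<^bsub>free_ring n\<^esub> x = \<zero>\<^bsub>free_ring n\<^esub>"
      if "x \<in> carrier (free_ring n)" for x :: "'k free"
      by (rule bexI[of _ "- x"]) (use that in \<open>auto intro: free_carrier_uminus\<close>)
  qed (auto intro: free_carrier_add simp: ac_simps)
  show "Group.monoid (free_ring n :: 'k free ring)"
    by (rule monoidI) (auto intro: free_carrier_mult simp: mult.assoc)
qed (auto simp: algebra_simps)

lemma a_inv_free_ring:
  assumes "x \<in> carrier (free_ring n)" shows "\<ominus>\<^bsub>free_ring n\<^esub> x = - (x :: 'k::field free)"
proof -
  interpret ring "free_ring n :: 'k free ring" by (rule ring_free_ring)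
  show ?thesis
    by (rule minus_equality) (use assms in \<open>auto intro: free_carrier_uminus\<close>)
qed

lemma ideal_free_ringI:
  fixes P :: "'k::field free set"
  assumes sub: "P \<subseteq> carrier (free_ring n)" and z: "0 \<in> P"
    and a: "\<And>x y. x \<in> P \<Longrightarrow> y \<in> P \<Longrightarrow> x + y \<in> P"
    and l: "\<And>x w c. x \<in> P \<Longrightarrow> w \<in> nwords n \<Longrightarrow> Poly_Mapping.single w c * x \<in> P"
    and r: "\<And>x w c. x \<in> P \<Longrightarrow> w \<in> nwords n \<Longrightarrow> x * Poly_Mapping.single w c \<in> P"
  shows "ideal P (free_ring n)"
proof (rule idealI)
  have "- x \<in> P" if "x \<in> P" for x
    using l[of x 0 "-1"] that by (simp add: single_uminus)
  moreover have "inv\<^bsub>add_monoid (free_ring n)\<^esub> x = - x" if "x \<in> P" for x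
    using a_inv_free_ring[of x n] sub that unfolding a_inv_def by blast
  ultimately show "subgroup P (add_monoid (free_ring n))"
    using sub z a by (intro subgroup.intro) auto
  show "x \<otimes>\<^bsub>free_ring n\<^esub> p \<in> P" if "p \<in> P" "x \<in> carrier (free_ring n)" for p x
  proof -
    have "x * p \<in> P"
      by (rule monomial_induct[where P = "\<lambda>x. x * p \<in> P" and A = "nwords n"])
        (use that in \<open>simp add: carrier_free_ring\<close>, use that z a l in \<open>auto simp: distrib_right\<close>)
    then show ?thesis by simp
  qed
  show "p \<otimes>\<^bsub>free_ring n\<^esub> x \<in> P" if "p \<in> P" "x \<in> carrier (free_ring n)" for p x
  proof -
    have "p * x \<in> P"
      by (rule monomial_induct[where P = "\<lambda>x. p * x \<in> P" and A = "nwords n"])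
        (use that in \<open>simp add: carrier_free_ring\<close>, use that z a r in \<open>auto simp: distrib_left\<close>)
    then show ?thesis by simp
  qed
qed (rule ring_free_ring)

lemma ideal_free_ringD:
  fixes I :: "'k::field free set"
  assumes "ideal I (free_ring n)"
  shows "I \<subseteq> carrier (free_ring n)" "0 \<in> I"
    "x \<in> I \<Longrightarrow> y \<in> I \<Longrightarrow> x + y \<in> I" "x \<in> I \<Longrightarrow> y \<in> I \<Longrightarrow> x - y \<in> I" "x \<in> I \<Longrightarrow> - x \<in> I"
    "x \<in> I \<Longrightarrow> y \<in> carrier (free_ring n) \<Longrightarrow> y * x \<in> I"
    "x \<in> I \<Longrightarrow> y \<in> carrier (free_ring n) \<Longrightarrow> x * y \<in> I"
proof -
  interpret ideal I "free_ring n" by fact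
  show sub: "I \<subseteq> carrier (free_ring n)" by (rule a_subset)
  show "0 \<in> I" using additive_subgroup.zero_closed[OF is_additive_subgroup] by simp
  show add: "x \<in> I \<Longrightarrow> y \<in> I \<Longrightarrow> x + y \<in> I" for x y
      using additive_subgroup.a_closed[OF is_additive_subgroup, of x y] by simp
  show uminus: "x \<in> I \<Longrightarrow> - x \<in> I" for x
    using additive_subgroup.a_inv_closed[OF is_additive_subgroup, of x] a_inv_free_ring[of x n] sub by auto
  show "x \<in> I \<Longrightarrow> y \<in> I \<Longrightarrow> x - y \<in> I" using add[of x "- y"] uminus by simp
  show "x \<in> I \<Longrightarrow> y \<in> carrier (free_ring n) \<Longrightarrow> y * x \<in> I" using I_l_closed[of x y] by simp
  show "x \<in> I \<Longrightarrow> y \<in> carrier (free_ring n) \<Longrightarrow> x * y \<in> I" using I_r_closed[of x y] by simp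
qed

text \<open>
  Requiring support on words with letters in \<open>{1..n} \<times> {1..n}\<close> makes this set stable under
  translation by arbitrary words, so that \<open>tens_annih\<close> is an ideal for all words and not just for
  those with letters in range.
\<close>

definition annih :: "nat \<Rightarrow> 'k::field free set \<Rightarrow> ((nat \<times> nat) word \<Rightarrow> 'k) set" where
  "annih n I = {\<phi>. (\<forall>w. w \<notin> nwords n \<longrightarrow> \<phi> w = 0) \<and> (\<forall>x\<in>I. lin_ext \<phi> x = 0)}"

text \<open>
  The part of \<open>I \<otimes> A + A \<otimes> I\<close> is played by the elements of the tensor square that all pairs of
  functionals killing \<open>I\<close> annihilate; for letters in range the two agree, \<open>k\<close> being a field.
\<close>

definition tens_annih ::
  "nat \<Rightarrow> 'k::field free set \<Rightarrow> ((nat \<times> nat) word \<times> (nat \<times> nat) word \<Rightarrow>\<^sub>0 'k) set" where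
  "tens_annih n I = {t. \<forall>\<phi>\<in>annih n I. \<forall>\<psi>\<in>annih n I. lin_ext (tens \<phi> \<psi>) t = 0}"

lemma annih_shift:
  fixes I :: "'k::field free set"
  assumes "ideal I (free_ring n)" "\<phi> \<in> annih n I"
  shows "(\<lambda>w. \<phi> (v + w)) \<in> annih n I" "(\<lambda>w. \<phi> (w + v)) \<in> annih n I"
proof -
  have "lin_ext (\<lambda>w. \<phi> (v + w)) x = 0 \<and> lin_ext (\<lambda>w. \<phi> (w + v)) x = 0" if "x \<in> I" for x
  proof (cases "v \<in> nwords n")
    case True
    then have "Poly_Mapping.single v 1 * x \<in> I" "x * Poly_Mapping.single v 1 \<in> I"
      using ideal_free_ringD(6,7)[OF assms(1) that] free_carrier_single by blast+
    then have "lin_ext \<phi> (Poly_Mapping.single v 1 * x) = 0" "lin_ext \<phi> (x * Poly_Mapping.single v 1) = 0"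
      using assms(2) by (auto simp: annih_def)
    then show "lin_ext (\<lambda>w. \<phi> (v + w)) x = 0 \<and> lin_ext (\<lambda>w. \<phi> (w + v)) x = 0"
      by (simp_all add: lin_ext_single_mult lin_ext_mult_single)
  next
    case False
    then have "\<phi> (v + w) = 0" "\<phi> (w + v) = 0" for w
      using assms(2) by (auto simp: annih_def)
    then show "lin_ext (\<lambda>w. \<phi> (v + w)) x = 0 \<and> lin_ext (\<lambda>w. \<phi> (w + v)) x = 0"
      by simp_all
  qed
  then show "(\<lambda>w. \<phi> (v + w)) \<in> annih n I" "(\<lambda>w. \<phi> (w + v)) \<in> annih n I"
    using assms(2) by (auto simp: annih_def)
qed

lemma tens_annih_two_sided:
  fixes I :: "'k::field free set"
  assumes I: "ideal I (free_ring n)"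
  shows "two_sided_ideal (tens_annih n I)"
proof
  show "s * t \<in> tens_annih n I" if t: "t \<in> tens_annih n I" for s t
  proof (induction s rule: monomial_induct[where A = UNIV])
    case (single vw c)
    obtain v w where vw: "vw = (v, w)" by force
    have "lin_ext (tens \<phi> \<psi>) (Poly_Mapping.single vw c * t) = 0"
      if "\<phi> \<in> annih n I" "\<psi> \<in> annih n I" for \<phi> \<psi>
    proof -
      have "lin_ext (tens (\<lambda>z. \<phi> (v + z)) (\<lambda>z. \<psi> (w + z))) t = 0"
        using t annih_shift[OF I] that by (auto simp: tens_annih_def)
      also have "tens (\<lambda>z. \<phi> (v + z)) (\<lambda>z. \<psi> (w + z)) = (\<lambda>z. tens \<phi> \<psi> (vw + z))"
        by (auto simp: tens_def vw)
      finally show ?thesis by (simp add: lin_ext_single_mult)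
    qed
    then show ?case by (simp add: tens_annih_def)
  qed (auto simp: tens_annih_def lin_ext_add distrib_right)
  show "t * s \<in> tens_annih n I" if t: "t \<in> tens_annih n I" for s t
  proof (induction s rule: monomial_induct[where A = UNIV])
    case (single vw c)
    obtain v w where vw: "vw = (v, w)" by force
    have "lin_ext (tens \<phi> \<psi>) (t * Poly_Mapping.single vw c) = 0"
      if "\<phi> \<in> annih n I" "\<psi> \<in> annih n I" for \<phi> \<psi>
    proof -
      have "lin_ext (tens (\<lambda>z. \<phi> (z + v)) (\<lambda>z. \<psi> (z + w))) t = 0"
        using t annih_shift[OF I] that by (auto simp: tens_annih_def)
      also have "tens (\<lambda>z. \<phi> (z + v)) (\<lambda>z. \<psi> (z + w)) = (\<lambda>z. tens \<phi> \<psi> (z + vw))"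
        by (auto simp: tens_def vw)
      finally show ?thesis by (simp add: lin_ext_mult_single)
    qed
    then show ?case by (simp add: tens_annih_def)
  qed (auto simp: tens_annih_def lin_ext_add distrib_left)
qed (auto simp: tens_annih_def lin_ext_add)

text \<open>
  The elements \<open>x\<close> all of whose translates \<open>v x w\<close> are killed form an ideal.
\<close>

lemma vanishes_on_genideal:
  fixes G :: "'k::field free set"
  assumes G: "G \<subseteq> carrier (free_ring n)"
    and v: "\<And>g v w. g \<in> G \<Longrightarrow> v \<in> nwords n \<Longrightarrow> w \<in> nwords n \<Longrightarrow> lin_ext (\<lambda>z. \<phi> (v + z + w)) g = 0"
    and x: "x \<in> Idl\<^bsub>free_ring n\<^esub> G"
  shows "lin_ext \<phi> x = 0"
proof -
  let ?P = "{x \<in> carrier (free_ring n). \<forall>v\<in>nwords n. \<forall>w\<in>nwords n. lin_ext (\<lambda>z. \<phi> (v + z + w)) x = 0}"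
  have "ideal ?P (free_ring n)"
  proof (rule ideal_free_ringI)
    show "Poly_Mapping.single u c * y \<in> ?P" if "y \<in> ?P" "u \<in> nwords n" for y u c
      using that by (auto simp: lin_ext_single_mult free_carrier_mult free_carrier_single simp flip: add.assoc)
    show "y * Poly_Mapping.single u c \<in> ?P" if "y \<in> ?P" "u \<in> nwords n" for y u c
      using that by (auto simp: lin_ext_mult_single free_carrier_mult free_carrier_single add.assoc)
  qed (auto simp: lin_ext_add free_carrier_add)
  moreover have "G \<subseteq> ?P" using G v by auto
  ultimately have "x \<in> ?P" using ring.genideal_minimal[OF ring_free_ring] x by blast
  then have "\<forall>v\<in>nwords n. \<forall>w\<in>nwords n. lin_ext (\<lambda>z. \<phi> (v + z + w)) x = 0" by blast
  from this[rule_format, of 0 0] show ?thesis by simp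
qed

definition letter_comult ::
  "nat \<Rightarrow> nat \<times> nat \<Rightarrow> ((nat \<times> nat) word \<times> (nat \<times> nat) word \<Rightarrow>\<^sub>0 'k::field)" where
  "letter_comult n = (\<lambda>(i, j). \<Sum>k=1..n. Poly_Mapping.single (Word [(i, k)], Word [(k, j)]) 1)"

definition word_comult ::
  "nat \<Rightarrow> (nat \<times> nat) word \<Rightarrow> ((nat \<times> nat) word \<times> (nat \<times> nat) word \<Rightarrow>\<^sub>0 'k::field)" where
  "word_comult n w = prod_list (map (letter_comult n) (letters w))"

lemma free_comult_eq: "free_comult n x = (\<Sum>w\<in>Poly_Mapping.keys x. const (Poly_Mapping.lookup x w)
    * word_comult n w)"
  by (simp add: free_comult_def free_lift_def word_comult_def letter_comult_def)

lemma word_comult_plus: "word_comult n (v + w) = word_comult n v * word_comult n w"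
  by (simp add: word_comult_def)

lemma word_comult_0 [simp]: "word_comult n 0 = 1"
  by (simp add: word_comult_def)

lemma free_comult_single: "free_comult n (Poly_Mapping.single w c) = const c * word_comult n w"
  by (cases "c = 0") (auto simp: free_comult_eq)

lemma free_comult_0 [simp]: "free_comult n 0 = 0" by (simp add: free_comult_eq)

lemma free_comult_superset:
  assumes "finite A" "Poly_Mapping.keys x \<subseteq> A"
  shows "free_comult n x = (\<Sum>w\<in>A. const (Poly_Mapping.lookup x w) * word_comult n w)"
  unfolding free_comult_eq
  by (rule sum.mono_neutral_left) (use assms in \<open>auto simp: in_keys_iff\<close>)

lemma free_comult_add: "free_comult n (x + y) = free_comult n x + free_comult n y"
proof -
  let ?A = "Poly_Mapping.keys x \<union> Poly_Mapping.keys y"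
  have "free_comult n z = (\<Sum>w\<in>?A. const (Poly_Mapping.lookup z w) * word_comult n w)" if
      "z \<in> {x, y, x + y}" for z
    by (rule free_comult_superset) (use that keys_add[of x y] in auto)
  then show ?thesis
    by (simp add: lookup_add distrib_right sum.distrib const_add)
qed

lemma left_const_commute:
  fixes x y :: "'m::monoid_add \<Rightarrow>\<^sub>0 'k::comm_ring_1"
  shows "x * (const c * y) = const c * (x * y)"
  by (metis const_commute mult.assoc)

lemma free_comult_single_mult:
  "free_comult n (Poly_Mapping.single v c * x) = const c * word_comult n v * free_comult n x"
proof (induction x rule: monomial_induct[where A = UNIV])
  case (single w d)
  show ?case
    by (simp only: mult_single free_comult_single word_comult_plus const_mult mult.assoc
        left_const_commute[of "word_comult n v"])
qed (auto simp: free_comult_add distrib_left)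

lemma free_comult_mult: "free_comult n (x * y) = free_comult n x * free_comult n y"
  by (induction x rule: monomial_induct[where A = UNIV])
    (auto simp: distrib_right free_comult_add free_comult_single_mult free_comult_single)

lemma free_comult_uminus: "free_comult n (- x) = - free_comult n x"
  using free_comult_add[of n x "- x"] by (simp add: eq_neg_iff_add_eq_0 add.commute)

lemma free_comult_diff: "free_comult n (x - y) = free_comult n x - free_comult n y"
  using free_comult_add[of n x "- y"] by (simp add: free_comult_uminus)

lemma free_comult_sum: "free_comult n (sum f A) = (\<Sum>i\<in>A. free_comult n (f i))"
  by (induction A rule: infinite_finite_induct) (auto simp: free_comult_add)

lemma free_comult_const: "free_comult n (const c) = const c"
  by (simp add: const_def free_comult_single)

lemma free_comult_1 [simp]: "free_comult n 1 = 1"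
  using free_comult_const[of n 1] by simp

lemma free_comult_power: "free_comult n (x ^ m) = free_comult n x ^ m"
  by (induction m) (auto simp: free_comult_mult)

lemma free_comult_Tgen: "free_comult n (Tgen i j)
    = (\<Sum>k=1..n. Poly_Mapping.single (Word [(i, k)], Word [(k, j)]) 1)"
  by (simp add: Tgen_def free_comult_single word_comult_def letter_comult_def)

lemma lin_ext_word_comult_Cons:
  "lin_ext (tens \<phi> \<psi>) (word_comult n (Word ((i, j) # w)))
   = (\<Sum>k=1..n. lin_ext (tens (\<lambda>v. \<phi> (Word [(i, k)] + v)) (\<lambda>v. \<psi> (Word [(k, j)] + v))) (word_comult n (Word w)))"
proof -
  have "tens (\<lambda>v. \<phi> (Word [(i, k)] + v)) (\<lambda>v. \<psi> (Word [(k, j)] + v))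
      = (\<lambda>z. tens \<phi> \<psi> ((Word [(i, k)], Word [(k, j)]) + z))" for k
    by (auto simp: tens_def)
  then show ?thesis
    by (simp add: Word_Cons[of "(i, j)" w] word_comult_plus)
      (simp add: word_comult_def letter_comult_def sum_distrib_right lin_ext_sum lin_ext_single_mult)
qed

text \<open>
  The coproduct is multiplicative and \<open>tens_annih n I\<close> is an ideal, so the coideal property need only
  be tested on generators.
\<close>

lemma coideal_genideal:
  fixes G :: "'k::field free set"
  assumes G: "G \<subseteq> carrier (free_ring n)" and I: "I = Idl\<^bsub>free_ring n\<^esub> G"
    and co: "\<And>g. g \<in> G \<Longrightarrow> free_comult n g \<in> tens_annih n I"
    and x: "x \<in> I"
  shows "free_comult n x \<in> tens_annih n I"
proof -
  have "ideal I (free_ring n)" unfolding I by (rule ring.genideal_ideal[OF ring_free_ring G])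
  then interpret T: two_sided_ideal "tens_annih n I" by (rule tens_annih_two_sided)
  let ?P = "{x \<in> carrier (free_ring n). free_comult n x \<in> tens_annih n I}"
  have "ideal ?P (free_ring n)"
    by (rule ideal_free_ringI)
      (auto simp: free_comult_add free_comult_mult free_carrier_mult free_carrier_add free_carrier_single
         intro: T.zero_mem T.add_mem T.mult_left_mem T.mult_right_mem)
  moreover have "G \<subseteq> ?P" using G co by auto
  ultimately show ?thesis using ring.genideal_minimal[OF ring_free_ring] x I by blast
qed

section \<open>The FRT relations\<close>

definition frt_rel :: "nat \<Rightarrow> 'k::field \<Rightarrow> (nat \<Rightarrow> nat \<Rightarrow> 'k) \<Rightarrow> nat \<Rightarrow> nat \<Rightarrow> nat \<Rightarrow> nat \<Rightarrow> 'k free" where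
  "frt_rel n r p i j a b =
     (\<Sum>k=1..n. \<Sum>l=1..n. const (Rcoeff r p i j k l) * (Tgen k a * Tgen l b))
        - (\<Sum>k=1..n. \<Sum>l=1..n. const (Rcoeff r p k l a b) * (Tgen i k * Tgen j l))"

lemma FRT_relations_eq:
  "FRT_relations n r p = {frt_rel n r p i j a b | i j a b. i \<in> {1..n} \<and> j \<in> {1..n} \<and> a \<in> {1..n} \<and> b \<in> {1..n}}"
  unfolding FRT_relations_def frt_rel_def ..

lemma FRT_relations_carrier: "FRT_relations n r p \<subseteq> carrier (free_ring n)"
  unfolding FRT_relations_eq frt_rel_def
  by (auto intro!: free_carrier_diff free_carrier_sum free_carrier_mult free_carrier_Tgen simp: )

lemma Tgen_mult_Tgen: "Tgen i a * Tgen j b = Poly_Mapping.single (Word [(i, a), (j, b)]) (1 :: 'k::field)"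
  by (simp add: Tgen_def mult_single Word_plus)

lemma sum_sum_delta:
  assumes "finite A" "finite B" "a \<in> A" "b \<in> B"
  shows "(\<Sum>k\<in>A. \<Sum>l\<in>B. if k = a \<and> l = b then c else 0) = (c :: 'c::comm_monoid_add)"
proof -
  have "(\<Sum>l\<in>B. if k = a \<and> l = b then c else 0) = (if k = a then c else 0)" for k
    by (cases "k = a") (simp_all add: assms)
  then show ?thesis by (simp only: sum.delta assms if_True)
qed

lemma sum_Rcoeff_lower:
  fixes f :: "nat \<Rightarrow> nat \<Rightarrow> 'k::field"
  assumes "i \<in> {1..n}" "j \<in> {1..n}"
  shows "(\<Sum>k=1..n. \<Sum>l=1..n. Rcoeff r p i j k l * f k l)
      = kappa r p i j * f j i + (if j < i then (r - 1) * f i j else 0)"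
proof -
  have "Rcoeff r p i j k l * f k l = (if k = j \<and> l = i then kappa r p i j * f j i else 0)
     + (if k = i \<and> l = j then if j < i then (r - 1) * f i j else 0 else 0)" for k l
    unfolding Rcoeff_def by (smt (verit) add_0 add_0_right mult_zero_left nat_neq_iff)
  then show ?thesis
    using assms by (simp only: sum.distrib sum_sum_delta finite_atLeastAtMost)
qed

lemma sum_Rcoeff_upper:
  fixes f :: "nat \<Rightarrow> nat \<Rightarrow> 'k::field"
  assumes "a \<in> {1..n}" "b \<in> {1..n}"
  shows "(\<Sum>k=1..n. \<Sum>l=1..n. Rcoeff r p k l a b * f k l)
      = kappa r p b a * f b a + (if b < a then (r - 1) * f a b else 0)"
proof -
  have "Rcoeff r p k l a b * f k l = (if k = b \<and> l = a then kappa r p b a * f b a else 0)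
     + (if k = a \<and> l = b then if b < a then (r - 1) * f a b else 0 else 0)" for k l
    unfolding Rcoeff_def by (smt (verit) add_0 add_0_right mult_zero_left nat_neq_iff)
  then show ?thesis
    using assms by (simp only: sum.distrib sum_sum_delta finite_atLeastAtMost)
qed

lemma lin_ext_frt_rel_sums:
  "lin_ext \<phi> (frt_rel n r p i j a b) =
     (\<Sum>k=1..n. \<Sum>l=1..n. Rcoeff r p i j k l * \<phi> (Word [(k, a), (l, b)]))
     - (\<Sum>k=1..n. \<Sum>l=1..n. Rcoeff r p k l a b * \<phi> (Word [(i, k), (j, l)]))"
  by (simp add: frt_rel_def lin_ext_diff lin_ext_sum lin_ext_const_mult Tgen_mult_Tgen)

lemma lin_ext_frt_rel:
  assumes "i \<in> {1..n}" "j \<in> {1..n}" "a \<in> {1..n}" "b \<in> {1..n}"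
  shows "lin_ext \<phi> (frt_rel n r p i j a b) =
     kappa r p i j * \<phi> (Word [(j, a), (i, b)]) + (if j < i then (r - 1) * \<phi> (Word [(i, a), (j, b)]) else 0)
     - (kappa r p b a * \<phi> (Word [(i, b), (j, a)]) + (if b < a then (r - 1) * \<phi> (Word [(i, a), (j, b)]) else 0))"
  unfolding lin_ext_frt_rel_sums
  using sum_Rcoeff_lower[OF assms(1,2), of r p "\<lambda>k l. \<phi> (Word [(k, a), (l, b)])"]
    sum_Rcoeff_upper[OF assms(3,4), of r p "\<lambda>k l. \<phi> (Word [(i, k), (j, l)])"]
  by simp

text \<open>
  With \<open>T\<^sub>1\<close>, \<open>T\<^sub>2\<close> the two copies of the generating matrix, the relations read \<open>R T\<^sub>1 T\<^sub>2 = T\<^sub>1 T\<^sub>2 R\<close>, and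
  the coproduct sends \<open>T\<^sub>1 T\<^sub>2\<close> to the product of the two copies of \<open>T\<^sub>1 T\<^sub>2\<close> in the tensor square. The
  matrix \<open>R\<close> is moved past the left copy and then past the right copy.
\<close>

lemma frt_rel_comult:
  fixes I :: "'k::field free set"
  assumes I: "FRT_relations n r p \<subseteq> I"
    and ij: "i \<in> {1..n}" "j \<in> {1..n}" "a \<in> {1..n}" "b \<in> {1..n}"
  shows "free_comult n (frt_rel n r p i j a b) \<in> tens_annih n I"
  unfolding tens_annih_def
proof (intro CollectI ballI)
  fix \<phi> \<psi> assume "\<phi> \<in> annih n I" "\<psi> \<in> annih n I"
  then have vanish: "lin_ext \<phi> (frt_rel n r p i j a b) = 0" "lin_ext \<psi> (frt_rel n r p i j a b) = 0"
    if "i \<in> {1..n}" "j \<in> {1..n}" "a \<in> {1..n}" "b \<in> {1..n}" for i j a b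
    using I that unfolding annih_def FRT_relations_eq by blast+
  let ?R = "Rcoeff r p" and ?N = "{1..n}"
  let ?f = "\<lambda>i k j l. \<phi> (Word [(i, k), (j, l)])" and ?g = "\<lambda>i k j l. \<psi> (Word [(i, k), (j, l)])"
  have rel: "(\<Sum>k\<in>?N. \<Sum>l\<in>?N. ?R i j k l * ?f k a l b) = (\<Sum>k\<in>?N. \<Sum>l\<in>?N. ?R k l a b * ?f i k j l)"
      "(\<Sum>k\<in>?N. \<Sum>l\<in>?N. ?R i j k l * ?g k a l b) = (\<Sum>k\<in>?N. \<Sum>l\<in>?N. ?R k l a b * ?g i k j l)"
    if "i \<in> ?N" "j \<in> ?N" "a \<in> ?N" "b \<in> ?N" for i j a b
    using vanish[OF that] by (simp_all add: lin_ext_frt_rel_sums)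
  have co: "lin_ext (tens \<phi> \<psi>) (free_comult n (const c * (Tgen k a * Tgen l b)))
     = (\<Sum>s\<in>?N. \<Sum>t\<in>?N. c * (?f k s l t * ?g s a t b))" for c k a l b
    unfolding free_comult_mult free_comult_const free_comult_Tgen sum_product
    by (simp add: lin_ext_const_mult lin_ext_sum mult_single Word_plus tens_def sum_distrib_left)
  have "(\<Sum>k\<in>?N. \<Sum>l\<in>?N. \<Sum>s\<in>?N. \<Sum>t\<in>?N. ?R i j k l * (?f k s l t * ?g s a t b))
      = (\<Sum>s\<in>?N. \<Sum>t\<in>?N. (\<Sum>k\<in>?N. \<Sum>l\<in>?N. ?R i j k l * ?f k s l t) * ?g s a t b)"
    unfolding sum_distrib_right sum_distrib_left mult.assoc
    by (subst (2) sum.swap, subst (3) sum.swap, subst sum.swap, subst (2) sum.swap) simp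
  also have "\<dots> = (\<Sum>s\<in>?N. \<Sum>t\<in>?N. (\<Sum>k\<in>?N. \<Sum>l\<in>?N. ?R k l s t * ?f i k j l) * ?g s a t b)"
    by (intro sum.cong refl arg_cong2[where f = "(*)"] rel ij)
  also have "\<dots> = (\<Sum>k\<in>?N. \<Sum>l\<in>?N. ?f i k j l * (\<Sum>s\<in>?N. \<Sum>t\<in>?N. ?R k l s t * ?g s a t b))"
    unfolding sum_distrib_right sum_distrib_left mult.assoc mult.left_commute[of "?f _ _ _ _"]
    by (subst (2) sum.swap, subst (3) sum.swap, subst sum.swap, subst (2) sum.swap) simp
  also have "\<dots> = (\<Sum>k\<in>?N. \<Sum>l\<in>?N. ?f i k j l * (\<Sum>s\<in>?N. \<Sum>t\<in>?N. ?R s t a b * ?g k s l t))"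
    by (intro sum.cong refl arg_cong2[where f = "(*)"] rel ij)
  also have "\<dots> = (\<Sum>k\<in>?N. \<Sum>l\<in>?N. \<Sum>s\<in>?N. \<Sum>t\<in>?N. ?R k l a b * (?f i s j t * ?g s k t l))"
    unfolding sum_distrib_right sum_distrib_left mult.assoc mult.left_commute[of "?f _ _ _ _"]
    by (subst (2) sum.swap, subst (3) sum.swap, subst sum.swap, subst (2) sum.swap) simp
  finally show "lin_ext (tens \<phi> \<psi>) (free_comult n (frt_rel n r p i j a b)) = 0"
    unfolding frt_rel_def free_comult_diff free_comult_sum lin_ext_diff lin_ext_sum co by simp
qed

section \<open>Functionals on the quotient\<close>

lemma FRT_ideal_ideal: "ideal (FRT_ideal n r p) (free_ring n)"
  unfolding FRT_ideal_def by (rule ring.genideal_ideal[OF ring_free_ring FRT_relations_carrier])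

lemma FRT_relations_sub_ideal: "FRT_relations n r p \<subseteq> FRT_ideal n r p"
  unfolding FRT_ideal_def by (rule ring.genideal_self[OF ring_free_ring FRT_relations_carrier])

lemma FRT_ideal_coideal:
  fixes x :: "'k::field free"
  assumes "x \<in> FRT_ideal n r p"
  shows "free_comult n x \<in> tens_annih n (FRT_ideal n r p)"
proof (rule coideal_genideal[OF FRT_relations_carrier FRT_ideal_def _ assms])
  fix g assume "g \<in> FRT_relations n r p"
  then show "free_comult n g \<in> tens_annih n (FRT_ideal n r p)"
    using frt_rel_comult[OF FRT_relations_sub_ideal] unfolding FRT_relations_eq by blast
qed

context
  fixes n :: nat and r :: "'k::field" and p :: "nat \<Rightarrow> nat \<Rightarrow> 'k"
begin

interpretation I: ideal "FRT_ideal n r p" "free_ring n :: 'k free ring"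
  by (rule FRT_ideal_ideal)

interpretation Q: ring "FRT n r p"
  unfolding FRT_def by (rule I.quotient_is_ring)

lemma ring_FRT: "ring (FRT n r p)"
  by (rule Q.ring_axioms)

lemma carrier_FRT: "carrier (FRT n r p) = FRT_proj n r p ` carrier (free_ring n)"
  by (auto simp: FRT_def FactRing_def A_RCOSETS_def' FRT_proj_def a_r_coset_def')

lemma proj_in_carrier: "x \<in> carrier (free_ring n) \<Longrightarrow> FRT_proj n r p x \<in> carrier (FRT n r p)"
  by (simp add: carrier_FRT)

lemma proj_hom: "FRT_proj n r p \<in> ring_hom (free_ring n) (FRT n r p)"
  using I.rcos_ring_hom unfolding FRT_proj_def FRT_def by (simp add: FRT_proj_def[abs_def] eta_contract_eq)

lemma proj_add: "x \<in> carrier (free_ring n) \<Longrightarrow> y \<in> carrier (free_ring n) \<Longrightarrow>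
    FRT_proj n r p x \<oplus>\<^bsub>FRT n r p\<^esub> FRT_proj n r p y = FRT_proj n r p (x + y)"
  using ring_hom_add[OF proj_hom] by simp

lemma proj_mult: "x \<in> carrier (free_ring n) \<Longrightarrow> y \<in> carrier (free_ring n) \<Longrightarrow>
    FRT_proj n r p x \<otimes>\<^bsub>FRT n r p\<^esub> FRT_proj n r p y = FRT_proj n r p (x * y)"
  using ring_hom_mult[OF proj_hom] by simp

lemma proj_one: "\<one>\<^bsub>FRT n r p\<^esub> = FRT_proj n r p 1"
  using ring_hom_one[OF proj_hom] by simp

lemma proj_zero: "\<zero>\<^bsub>FRT n r p\<^esub> = FRT_proj n r p 0"
  using ring_hom_zero[OF proj_hom ring_free_ring ring_FRT] by simp

lemma proj_diff:
  assumes "x \<in> carrier (free_ring n)" "y \<in> carrier (free_ring n)"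
  shows "FRT_proj n r p x \<ominus>\<^bsub>FRT n r p\<^esub> FRT_proj n r p y = FRT_proj n r p (x - y)"
proof -
  have "\<ominus>\<^bsub>FRT n r p\<^esub> FRT_proj n r p y = FRT_proj n r p (- y)"
    by (rule Q.minus_equality)
      (use assms in \<open>auto simp: proj_add proj_zero proj_in_carrier free_carrier_uminus\<close>)
  then show ?thesis
    using assms by (simp add: a_minus_def proj_add free_carrier_uminus)
qed

lemma proj_scale: "x \<in> carrier (free_ring n) \<Longrightarrow> FRT_scale n r p c (FRT_proj n r p x)
    = FRT_proj n r p (const c * x)"
  by (simp add: FRT_scale_def proj_mult)

lemma proj_as_translate: "FRT_proj n r p x = (\<lambda>y. y + x) ` FRT_ideal n r p"
  by (auto simp: FRT_proj_def a_r_coset_def')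

lemma proj_mem_iff: "y \<in> FRT_proj n r p x \<longleftrightarrow> y - x \<in> FRT_ideal n r p"
  unfolding proj_as_translate by (auto simp: image_iff) (metis diff_add_cancel)

lemma proj_eqD:
  assumes "FRT_proj n r p x = FRT_proj n r p y" shows "x - y \<in> FRT_ideal n r p"
  using assms proj_mem_iff[of x x] proj_mem_iff[of x y] ideal_free_ringD(2)[OF FRT_ideal_ideal] by auto

lemma proj_eqI:
  assumes "x - y \<in> FRT_ideal n r p" shows "FRT_proj n r p x = FRT_proj n r p y"
proof -
  have "z - x \<in> FRT_ideal n r p \<longleftrightarrow> z - y \<in> FRT_ideal n r p" for z
    using ideal_free_ringD(3)[OF FRT_ideal_ideal _ assms, of "z - x"]
      ideal_free_ringD(4)[OF FRT_ideal_ideal _ assms, of "z - y"] by (auto simp: algebra_simps)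
  then show ?thesis by (auto simp: proj_mem_iff set_eq_iff)
qed

lemma proj_in_carrierD:
  assumes "FRT_proj n r p x \<in> carrier (FRT n r p)" shows "x \<in> carrier (free_ring n)"
proof -
  obtain y where "y \<in> carrier (free_ring n)" "FRT_proj n r p x = FRT_proj n r p y"
    using assms by (auto simp: carrier_FRT)
  then show ?thesis
    using proj_eqD[of x y] ideal_free_ringD(1)[OF FRT_ideal_ideal, of n r p] free_carrier_add[of
        "x - y" n y] by auto
qed

lemma coset_rep_proj: "coset_rep (FRT_proj n r p x) - x \<in> FRT_ideal n r p"
proof -
  have "x \<in> FRT_proj n r p x"
    using ideal_free_ringD(2)[OF FRT_ideal_ideal] by (simp add: proj_mem_iff)
  then have "coset_rep (FRT_proj n r p x) \<in> FRT_proj n r p x"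
    unfolding coset_rep_def by (rule someI)
  then show ?thesis by (simp add: proj_mem_iff)
qed

lemma coset_rep_carrier:
  assumes "a \<in> carrier (FRT n r p)"
  shows "coset_rep a \<in> carrier (free_ring n)" "FRT_proj n r p (coset_rep a) = a"
proof -
  obtain x where x: "x \<in> carrier (free_ring n)" "a = FRT_proj n r p x"
    using assms by (auto simp: carrier_FRT)
  show "FRT_proj n r p (coset_rep a) = a"
    unfolding x(2) by (rule proj_eqI) (rule coset_rep_proj)
  then show "coset_rep a \<in> carrier (free_ring n)"
    using assms proj_in_carrierD by metis
qed

definition word_fun :: "('k free set \<Rightarrow> 'k) \<Rightarrow> (nat \<times> nat) word \<Rightarrow> 'k" where
  "word_fun u w = u (FRT_proj n r p (Poly_Mapping.single w 1))"

definition functional_of :: "((nat \<times> nat) word \<Rightarrow> 'k) \<Rightarrow> 'k free set \<Rightarrow> 'k" where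
  "functional_of \<phi> a = (if a \<in> carrier (FRT n r p) then lin_ext \<phi> (coset_rep a) else 0)"

lemma functional_proj:
  assumes u: "u \<in> functionals n r p" and x: "x \<in> carrier (free_ring n)"
  shows "u (FRT_proj n r p x) = lin_ext (word_fun u) x"
proof -
  have add: "u (FRT_proj n r p (x + y)) = u (FRT_proj n r p x) + u (FRT_proj n r p y)"
    if "x \<in> carrier (free_ring n)" "y \<in> carrier (free_ring n)" for x y
    using u that by (simp add: functionals_def proj_in_carrier flip: proj_add)
  have scale: "u (FRT_proj n r p (const c * x)) = c * u (FRT_proj n r p x)"
    if "x \<in> carrier (free_ring n)" for x c
    using u that by (simp add: functionals_def proj_in_carrier flip: proj_scale)
  have "x \<in> carrier (free_ring n) \<and> u (FRT_proj n r p x) = lin_ext (word_fun u) x"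
  proof (rule monomial_induct[where A = "nwords n"])
    show "Poly_Mapping.keys x \<subseteq> nwords n" using x by (simp add: carrier_free_ring)
    show "0 \<in> carrier (free_ring n) \<and> u (FRT_proj n r p 0) = lin_ext (word_fun u) 0"
      using scale[of 0 0] by simp
  next
    fix w :: "(nat \<times> nat) word" and c :: 'k assume w: "w \<in> nwords n"
    then show "Poly_Mapping.single w c \<in> carrier (free_ring n) \<and>
        u (FRT_proj n r p (Poly_Mapping.single w c)) = lin_ext (word_fun u) (Poly_Mapping.single w c)"
      using scale[of "Poly_Mapping.single w 1" c]
      by (simp add: free_carrier_single const_mult_single word_fun_def)
  qed (auto simp: add lin_ext_add free_carrier_add)
  then show ?thesis ..
qed

lemma word_fun_annih:
  assumes u: "u \<in> functionals n r p"
  shows "word_fun u \<in> annih n (FRT_ideal n r p)"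
  unfolding annih_def
proof (intro CollectI conjI allI impI ballI)
  fix w assume "w \<notin> nwords n"
  then have "Poly_Mapping.single w (1::'k) \<notin> carrier (free_ring n)"
    by (simp add: carrier_free_ring)
  then have "FRT_proj n r p (Poly_Mapping.single w 1) \<notin> carrier (FRT n r p)"
    using proj_in_carrierD by blast
  then show "word_fun u w = 0" using u by (simp add: functionals_def word_fun_def)
next
  fix x assume x: "x \<in> FRT_ideal n r p"
  then have "x \<in> carrier (free_ring n)" using ideal_free_ringD(1)[OF FRT_ideal_ideal] by blast
  moreover have "FRT_proj n r p x = FRT_proj n r p 0" by (rule proj_eqI) (use x in simp)
  ultimately show "lin_ext (word_fun u) x = 0"
    using functional_proj[OF u, of x] functional_proj[OF u, of 0] by simp
qed

lemma functional_of_proj: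
  assumes \<phi>: "\<phi> \<in> annih n (FRT_ideal n r p)" and x: "x \<in> carrier (free_ring n)"
  shows "functional_of \<phi> (FRT_proj n r p x) = lin_ext \<phi> x"
  using coset_rep_proj[of x] \<phi> proj_in_carrier[OF x] by (auto simp: functional_of_def annih_def lin_ext_diff)

lemma functional_of_in_functionals:
  assumes \<phi>: "\<phi> \<in> annih n (FRT_ideal n r p)"
  shows "functional_of \<phi> \<in> functionals n r p"
  unfolding functionals_def
proof (intro CollectI conjI ballI allI impI)
  fix a b assume "a \<in> carrier (FRT n r p)" "b \<in> carrier (FRT n r p)"
  then obtain x y where "x \<in> carrier (free_ring n)" "y \<in> carrier (free_ring n)" "a = FRT_proj n r p x"
      "b = FRT_proj n r p y"
    by (auto simp: carrier_FRT)
  then show "functional_of \<phi> (a \<oplus>\<^bsub>FRT n r p\<^esub> b) = functional_of \<phi> a + functional_of \<phi> b"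
    by (simp add: proj_add functional_of_proj[OF \<phi>] free_carrier_add lin_ext_add)
next
  fix a c assume "a \<in> carrier (FRT n r p)"
  then obtain x where "x \<in> carrier (free_ring n)" "a = FRT_proj n r p x"
    by (auto simp: carrier_FRT)
  then show "functional_of \<phi> (FRT_scale n r p c a) = c * functional_of \<phi> a"
    by (simp add: proj_scale functional_of_proj[OF \<phi>] free_carrier_mult lin_ext_const_mult)
qed (simp add: functional_of_def)

lemma word_fun_functional_of:
  assumes \<phi>: "\<phi> \<in> annih n (FRT_ideal n r p)"
  shows "word_fun (functional_of \<phi>) = \<phi>"
proof
  fix w show "word_fun (functional_of \<phi>) w = \<phi> w"
  proof (cases "w \<in> nwords n")
    case True
    then show ?thesis by (simp add: word_fun_def functional_of_proj[OF \<phi>] free_carrier_single)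
  next
    case False
    then show ?thesis
      using \<phi> word_fun_annih[OF functional_of_in_functionals[OF \<phi>]] by (simp add: annih_def)
  qed
qed

lemma functional_eqI:
  assumes u: "u \<in> functionals n r p" and v: "v \<in> functionals n r p"
    and eq: "\<And>w. w \<in> nwords n \<Longrightarrow> word_fun u w = word_fun v w"
  shows "u = v"
proof
  have "word_fun u = word_fun v"
  proof
    fix w show "word_fun u w = word_fun v w"
      using eq[of w] word_fun_annih[OF u] word_fun_annih[OF v]
      by (cases "w \<in> nwords n") (simp_all add: annih_def)
  qed
  then have "u a = v a" if "a \<in> carrier (FRT n r p)" for a
    using functional_proj[OF u] functional_proj[OF v] that by (auto simp: carrier_FRT)
  then show "u a = v a" for a
    using u v by (cases "a \<in> carrier (FRT n r p)") (auto simp: functionals_def)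
qed

lemma convolution_eq:
  "convolution n r p u v a =
    (if a \<in> carrier (FRT n r p) then lin_ext (tens (word_fun u) (word_fun v)) (free_comult n
        (coset_rep a)) else 0)"
  by (simp add: convolution_def Let_def lin_ext_def tens_def word_fun_def case_prod_unfold mult.assoc)

text \<open>
  The coideal property makes the convolution independent of the chosen coset representative.
\<close>

lemma convolution_proj:
  assumes u: "u \<in> functionals n r p" and v: "v \<in> functionals n r p" and x: "x \<in> carrier (free_ring n)"
  shows "convolution n r p u v (FRT_proj n r p x) = lin_ext (tens (word_fun u) (word_fun v)) (free_comult n x)"
proof -
  have "free_comult n (coset_rep (FRT_proj n r p x) - x) \<in> tens_annih n (FRT_ideal n r p)"
    by (rule FRT_ideal_coideal) (rule coset_rep_proj)
  then have "lin_ext (tens (word_fun u) (word_fun v)) (free_comult n (coset_rep (FRT_proj n r p x) - x)) = 0"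
    using word_fun_annih[OF u] word_fun_annih[OF v] by (simp add: tens_annih_def)
  then show ?thesis
    using proj_in_carrier[OF x] by (simp add: convolution_eq free_comult_diff lin_ext_diff)
qed

lemma word_fun_convolution:
  assumes "u \<in> functionals n r p" "v \<in> functionals n r p" "w \<in> nwords n"
  shows "word_fun (convolution n r p u v) w = lin_ext (tens (word_fun u) (word_fun v)) (word_comult n w)"
  using assms by (simp add: word_fun_def[of
      "convolution n r p u v"] convolution_proj free_carrier_single free_comult_single)

lemma convolution_in_functionals:
  assumes u: "u \<in> functionals n r p" and v: "v \<in> functionals n r p"
  shows "convolution n r p u v \<in> functionals n r p"
  unfolding functionals_def
proof (intro CollectI conjI ballI allI impI)
  fix a b assume "a \<in> carrier (FRT n r p)" "b \<in> carrier (FRT n r p)"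
  then obtain x y where "x \<in> carrier (free_ring n)" "y \<in> carrier (free_ring n)" "a = FRT_proj n r p x"
      "b = FRT_proj n r p y"
    by (auto simp: carrier_FRT)
  then show "convolution n r p u v (a \<oplus>\<^bsub>FRT n r p\<^esub> b) = convolution n r p u v a + convolution n r p u v b"
    by (simp add: proj_add convolution_proj[OF u v] free_carrier_add free_comult_add lin_ext_add)
next
  fix a c assume "a \<in> carrier (FRT n r p)"
  then obtain x where "x \<in> carrier (free_ring n)" "a = FRT_proj n r p x"
    by (auto simp: carrier_FRT)
  then show "convolution n r p u v (FRT_scale n r p c a) = c * convolution n r p u v a"
    by (simp add: proj_scale convolution_proj[OF u v] free_carrier_mult free_comult_mult
        free_comult_const lin_ext_const_mult)
qed (simp add: convolution_def)

end

section \<open>Group-like and skew-primitive functionals\<close>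

lemma FRT_ideal_subset:
  fixes I :: "'k::field free set"
  assumes "ideal I (free_ring n)" "FRT_relations n r p \<subseteq> I"
  shows "FRT_ideal n r p \<subseteq> I"
  unfolding FRT_ideal_def using assms by (rule ring.genideal_minimal[OF ring_free_ring])

lemma single_sum: "Poly_Mapping.single w (sum f A) = (\<Sum>a\<in>A. Poly_Mapping.single w (f a))"
  by (induction A rule: infinite_finite_induct) (auto simp: single_add)

context
  fixes n :: nat and r :: "'k::field" and p :: "nat \<Rightarrow> nat \<Rightarrow> 'k"
begin

lemma finsum_proj:
  assumes "finite S" "\<And>s. s \<in> S \<Longrightarrow> h s \<in> carrier (free_ring n)"
  shows "(\<Oplus>\<^bsub>FRT n r p\<^esub>s\<in>S. FRT_proj n r p (h s)) = FRT_proj n r p (\<Sum>s\<in>S. h s)"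
proof -
  interpret Q: ring "FRT n r p" by (rule ring_FRT)
  show ?thesis
    using assms
  proof (induction S)
    case empty
    then show ?case by (simp add: proj_zero)
  next
    case (insert s S)
    then show ?case
      by (subst Q.finsum_insert) (auto simp: proj_add proj_in_carrier free_carrier_sum)
  qed
qed

lemma ideal_proj_image:
  assumes I: "ideal I (free_ring n)"
  shows "ideal (FRT_proj n r p ` I) (FRT n r p)"
proof (rule idealI)
  note D = ideal_free_ringD[OF I]
  have sub: "x \<in> carrier (free_ring n)" if "x \<in> I" for x using D(1) that by blast
  interpret Q: ring "FRT n r p" by (rule ring_FRT)
  have minus: "\<ominus>\<^bsub>FRT n r p\<^esub> FRT_proj n r p x = FRT_proj n r p (- x)" if "x \<in> I" for x
    by (rule Q.minus_equality) (use that sub in \<open>auto simp: proj_add proj_zero proj_in_carrier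
        free_carrier_uminus\<close>)
  show "subgroup (FRT_proj n r p ` I) (add_monoid (FRT n r p))"
  proof (rule subgroup.intro)
    show "inv\<^bsub>add_monoid (FRT n r p)\<^esub> a \<in> FRT_proj n r p ` I" if "a \<in> FRT_proj n r p ` I" for a
      using that minus D(5) unfolding a_inv_def by auto
  qed (use sub D in \<open>auto simp: proj_in_carrier proj_add proj_zero\<close>)
  show "x \<otimes>\<^bsub>FRT n r p\<^esub> a \<in> FRT_proj n r p ` I" "a \<otimes>\<^bsub>FRT n r p\<^esub> x \<in> FRT_proj n r p ` I"
    if "a \<in> FRT_proj n r p ` I" "x \<in> carrier (FRT n r p)" for a x
    using that sub D by (auto simp: carrier_FRT proj_mult)
qed (rule ring_FRT)

text \<open>
  Distinct words of \<open>A\<close> may have the same class. The coefficient of a class is therefore the sum of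
  the coefficients of the words in it, and one representative \<open>g s\<close> is fixed for every class \<open>s\<close>.
\<close>

lemma finite_codim_proj_image:
  assumes I: "ideal I (free_ring n)" and I0: "FRT_ideal n r p \<subseteq> I"
    and A: "finite A" "A \<subseteq> nwords n"
    and span: "\<And>x. x \<in> carrier (free_ring n) \<Longrightarrow> \<exists>y. Poly_Mapping.keys y \<subseteq> A \<and> x - y \<in> I"
  shows "finite_codim n r p (FRT_proj n r p ` I)"
proof -
  note D = ideal_free_ringD[OF I]
  define f where "f w = FRT_proj n r p (Poly_Mapping.single w 1)" for w
  obtain g where g: "\<And>s. s \<in> f ` A \<Longrightarrow> g s \<in> A \<and> f (g s) = s"
    using that[of "inv_into A f"] by (simp add: f_inv_into_f inv_into_into)
  have gc: "Poly_Mapping.single (g s) c \<in> carrier (free_ring n)" if "s \<in> f ` A" for s c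
    using g[OF that] A(2) by (intro free_carrier_single) blast
  have "\<exists>c. a \<ominus>\<^bsub>FRT n r p\<^esub> (\<Oplus>\<^bsub>FRT n r p\<^esub>s\<in>f ` A. FRT_scale n r p (c s) s) \<in> FRT_proj n r p ` I"
    if a: "a \<in> carrier (FRT n r p)" for a
  proof -
    obtain x where x: "x \<in> carrier (free_ring n)" "a = FRT_proj n r p x"
      using a by (auto simp: carrier_FRT)
    obtain y where y: "Poly_Mapping.keys y \<subseteq> A" "x - y \<in> I" using span[OF x(1)] by blast
    define c where "c s = (\<Sum>w\<in>{w \<in> A. f w = s}. Poly_Mapping.lookup y w)" for s
    define y' where "y' = (\<Sum>s\<in>f ` A. Poly_Mapping.single (g s) (c s))"
    have "y = (\<Sum>w\<in>A. Poly_Mapping.single w (Poly_Mapping.lookup y w))"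
      by (subst sum_monomials, rule sum.mono_neutral_left) (use A(1) y(1) in \<open>auto simp: in_keys_iff\<close>)
    also have "\<dots> = (\<Sum>s\<in>f ` A. \<Sum>w\<in>{w \<in> A. f w = s}. Poly_Mapping.single w (Poly_Mapping.lookup y w))"
      by (rule sum.group[symmetric]) (use A(1) in auto)
    finally have diff: "y - y' = (\<Sum>s\<in>f ` A. \<Sum>w\<in>{w \<in> A. f w = s}.
        Poly_Mapping.single w (Poly_Mapping.lookup y w) - Poly_Mapping.single (g s) (Poly_Mapping.lookup y w))"
      unfolding y'_def c_def by (simp add: sum_subtractf single_sum)
    have single_diff_mem: "Poly_Mapping.single w d - Poly_Mapping.single (g s) d \<in> I" if "w \<in> A"
        "s = f w" for w s d
    proof -
      have "Poly_Mapping.single w 1 - Poly_Mapping.single (g s) 1 \<in> FRT_ideal n r p"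
        by (rule proj_eqD) (use g[of s] that in \<open>simp add: f_def\<close>)
      then have "const d * (Poly_Mapping.single w 1 - Poly_Mapping.single (g s) 1) \<in> I"
        using I0 by (intro D(6)) auto
      then show ?thesis by (simp add: right_diff_distrib const_mult_single)
    qed
    have sumI: "sum h B \<in> I" if "\<And>b. b \<in> B \<Longrightarrow> h b \<in> I" for h and B :: "'z set"
      using that by (induction B rule: infinite_finite_induct) (auto intro: D(2,3))
    have "y - y' \<in> I"
      unfolding diff by (intro sumI single_diff_mem) auto
    then have "x - y' \<in> I" using D(3)[OF y(2), of "y - y'"] by simp
    moreover have "(\<Oplus>\<^bsub>FRT n r p\<^esub>s\<in>f ` A. FRT_scale n r p (c s) s) = FRT_proj n r p y'"
    proof -
      interpret Q: ring "FRT n r p" by (rule ring_FRT)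
      have "FRT_scale n r p (c s) s = FRT_proj n r p (Poly_Mapping.single (g s) (c s))" if "s \<in> f ` A" for s
      proof -
        have "FRT_scale n r p (c s) (FRT_proj n r p (Poly_Mapping.single (g s) 1))
            = FRT_proj n r p (Poly_Mapping.single (g s) (c s))"
          by (simp add: proj_scale gc that const_mult_single)
        then show ?thesis using g[OF that] by (simp add: f_def)
      qed
      then have "(\<Oplus>\<^bsub>FRT n r p\<^esub>s\<in>f ` A. FRT_scale n r p (c s) s)
          = (\<Oplus>\<^bsub>FRT n r p\<^esub>s\<in>f ` A. FRT_proj n r p (Poly_Mapping.single (g s) (c s)))"
        by (intro Q.finsum_cong') (auto simp: gc proj_in_carrier)
      also have "\<dots> = FRT_proj n r p y'"
        unfolding y'_def by (rule finsum_proj) (use A(1) gc in auto)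
      finally show ?thesis .
    qed
    moreover have "y' \<in> carrier (free_ring n)"
      unfolding y'_def by (intro free_carrier_sum gc)
    ultimately have "a \<ominus>\<^bsub>FRT n r p\<^esub> (\<Oplus>\<^bsub>FRT n r p\<^esub>s\<in>f ` A. FRT_scale n r p (c s) s) \<in> FRT_proj n r p ` I"
      using x by (simp add: proj_diff)
    then show ?thesis by blast
  qed
  moreover have "f ` A \<subseteq> carrier (FRT n r p)"
    unfolding f_def by (auto intro!: proj_in_carrier free_carrier_single A(2)[THEN subsetD])
  ultimately show ?thesis
    unfolding finite_codim_def using A(1) by (intro exI[of _ "f ` A"]) blast
qed

lemma finite_dual_memI:
  assumes u: "u \<in> functionals n r p"
    and I: "ideal I (free_ring n)" "FRT_ideal n r p \<subseteq> I"
    and A: "finite A" "A \<subseteq> nwords n"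
      "\<And>x. x \<in> carrier (free_ring n) \<Longrightarrow> \<exists>y. Poly_Mapping.keys y \<subseteq> A \<and> x - y \<in> I"
    and v: "word_fun n r p u \<in> annih n I"
  shows "u \<in> carrier (finite_dual n r p)"
proof -
  have "u a = 0" if "a \<in> FRT_proj n r p ` I" for a
    using that v functional_proj[OF u] ideal_free_ringD(1)[OF I(1)] by (auto simp: annih_def)
  then show ?thesis
    using u ideal_proj_image[OF I(1)] finite_codim_proj_image[OF I A] by (auto simp: finite_dual_def)
qed

end

text \<open>
  The diagonal characters of the bialgebra, as functions on words.
\<close>

definition chi :: "nat \<Rightarrow> (nat \<Rightarrow> 'k::field) \<Rightarrow> (nat \<times> nat) word \<Rightarrow> 'k" where
  "chi n d w = prod_list (map (\<lambda>(i, j). if i = j \<and> i \<in> {1..n} then d i else 0) (letters w))"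

lemma chi_plus: "chi n d (v + w) = chi n d v * chi n d w"
  by (simp add: chi_def)

lemma chi_0 [simp]: "chi n d 0 = 1"
  by (simp add: chi_def)

lemma chi_Nil [simp]: "chi n d (Word []) = 1"
  by (simp add: chi_def)

lemma chi_Cons [simp]: "chi n d (Word ((i, j) # w)) = (if i = j
    \<and> i \<in> {1..n} then d i else 0) * chi n d (Word w)"
  by (simp add: chi_def)

lemma chi_outside: "w \<notin> nwords n \<Longrightarrow> chi n d w = 0"
  by (cases w) (force simp: chi_def nwords_def prod_list_zero_iff split: if_splits)

text \<open>
  The unique function \<open>u\<close> with prescribed values \<open>e\<close> on letters and \<open>u (v w) = chi d v u w + u v chi d' w\<close>, that
  is, the skew-primitive functional with coproduct \<open>chi d \<otimes> u + u \<otimes> chi d'\<close>.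
\<close>

fun skew_list :: "nat \<Rightarrow> (nat \<Rightarrow> 'k::field) \<Rightarrow> (nat \<times> nat \<Rightarrow> 'k) \<Rightarrow> (nat \<Rightarrow> 'k) \<Rightarrow> (nat \<times> nat) list \<Rightarrow> 'k" where
  "skew_list n d e d' [] = 0"
| "skew_list n d e d' (x # w) = chi n d (Word [x]) * skew_list n d e d' w + e x * chi n d' (Word w)"

definition skew :: "nat \<Rightarrow> (nat \<Rightarrow> 'k::field) \<Rightarrow> (nat \<times> nat \<Rightarrow> 'k) \<Rightarrow> (nat \<Rightarrow> 'k) \<Rightarrow> (nat \<times> nat) word \<Rightarrow> 'k" where
  "skew n d e d' w = skew_list n d e d' (letters w)"

lemma skew_Nil [simp]: "skew n d e d' (Word []) = 0"
  by (simp add: skew_def)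

lemma skew_0 [simp]: "skew n d e d' 0 = 0"
  by (simp add: skew_def)

lemma skew_Cons [simp]: "skew n d e d' (Word (x # w))
    = chi n d (Word [x]) * skew n d e d' (Word w) + e x * chi n d' (Word w)"
  by (simp add: skew_def)

lemma skew_plus: "skew n d e d' (v + w) = chi n d v * skew n d e d' w + skew n d e d' v * chi n d' w"
proof -
  have "skew n d e d' (Word v + w) = chi n d (Word v) * skew n d e d' w + skew n d e d' (Word v)
      * chi n d' w" for v
  proof (induction v)
    case Nil
    then show ?case by (simp add: Word_Nil)
  next
    case (Cons x v)
    have 1: "skew n d e d' (Word (x # v) + w)
        = chi n d (Word [x]) * skew n d e d' (Word v + w) + e x * chi n d' (Word v + w)"
      by (simp add: skew_def plus_word_def)
    have 2: "chi n d (Word (x # v)) = chi n d (Word [x]) * chi n d (Word v)"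
      by (simp add: chi_def)
    show ?case
      unfolding 1 2 Cons skew_Cons chi_plus by (simp add: algebra_simps)
  qed
  then show ?thesis by (metis word.collapse)
qed

lemma skew_outside:
  assumes "w \<notin> nwords n" "\<And>x. x \<notin> {1..n} \<times> {1..n} \<Longrightarrow> e x = 0"
  shows "skew n d e d' w = 0"
proof -
  have "skew n d e d' (Word v) = 0" if "Word v \<notin> nwords n" for v
    using that
  proof (induction v)
    case (Cons x v)
    show ?case
    proof (cases "Word v \<in> nwords n")
      case True
      then have "x \<notin> {1..n} \<times> {1..n}" using Cons.prems by (cases x) auto
      then show ?thesis using assms(2) by (cases x) auto
    next
      case False
      then show ?thesis using Cons.IH by (simp add: chi_outside)
    qed
  qed simp
  then show ?thesis using assms(1) by (metis word.collapse)
qed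

lemma lin_ext_factor: "lin_ext (\<lambda>z. c * \<phi> z * d) x = c * lin_ext \<phi> x * d"
  by (simp add: lin_ext_def sum_distrib_left sum_distrib_right mult_ac)

lemma lin_ext_factor_left: "lin_ext (\<lambda>z. c * \<phi> z) x = c * lin_ext \<phi> x"
  using lin_ext_factor[of c \<phi> 1 x] by simp

lemma lin_ext_add_fun: "lin_ext (\<lambda>z. \<phi> z + \<psi> z) x = lin_ext \<phi> x + lin_ext \<psi> x"
  by (simp add: lin_ext_def sum.distrib distrib_left)

lemma chi_annih_genideal:
  assumes G: "G \<subseteq> carrier (free_ring n)" and v: "\<And>g. g \<in> G \<Longrightarrow> lin_ext (chi n d) g = 0"
  shows "chi n d \<in> annih n (Idl\<^bsub>free_ring n\<^esub> G)"
  unfolding annih_def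
  using vanishes_on_genideal[OF G, of "chi n d"] v by (auto simp: chi_outside chi_plus lin_ext_factor)

lemma skew_annih_genideal:
  assumes G: "G \<subseteq> carrier (free_ring n)"
    and v: "\<And>g. g \<in> G \<Longrightarrow> lin_ext (chi n d) g = 0" "\<And>g. g \<in> G \<Longrightarrow> lin_ext (chi n d') g = 0"
      "\<And>g. g \<in> G \<Longrightarrow> lin_ext (skew n d e d') g = 0"
    and e: "\<And>x. x \<notin> {1..n} \<times> {1..n} \<Longrightarrow> e x = 0"
  shows "skew n d e d' \<in> annih n (Idl\<^bsub>free_ring n\<^esub> G)"
proof -
  have "lin_ext (\<lambda>z. skew n d e d' (v + z + w)) g = 0" if "g \<in> G" for g v w
  proof -
    have "(\<lambda>z. skew n d e d' (v + z + w)) =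
      (\<lambda>z. chi n d v * chi n d z * skew n d e d' w + (chi n d v * skew n d e d' z * chi n d' w
        + skew n d e d' v * chi n d' z * chi n d' w))"
      by (simp add: skew_plus chi_plus algebra_simps)
    then show ?thesis using v[OF that] by (simp add: lin_ext_add_fun lin_ext_factor)
  qed
  then show ?thesis
    unfolding annih_def using vanishes_on_genideal[OF G, of "skew n d e d'"] skew_outside[OF _ e] by auto
qed

lemma lin_ext_mult:
  fixes \<phi> :: "'m::monoid_add \<Rightarrow> 'k::comm_ring_1"
  assumes "\<And>v w. \<phi> (v + w) = \<phi> v * \<phi> w"
  shows "lin_ext \<phi> (x * y) = lin_ext \<phi> x * lin_ext \<phi> y"
  by (induction x rule: monomial_induct[where A = UNIV])
    (auto simp: distrib_right lin_ext_add lin_ext_single_mult assms lin_ext_factor_left mult.assoc)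

lemma lin_ext_skew_mult:
  "lin_ext (skew n d e d') (x * y) = lin_ext (chi n d) x * lin_ext (skew n d e d') y + lin_ext
      (skew n d e d') x * lin_ext (chi n d') y"
proof (induction x rule: monomial_induct[where A = UNIV])
  case (single w c)
  show ?case
    unfolding lin_ext_single_mult skew_plus lin_ext_add_fun lin_ext_factor_left lin_ext_single
    by (simp add: algebra_simps)
qed (auto simp: distrib_right lin_ext_add algebra_simps)

text \<open>
  \<open>R\<close> preserves weights, so it commutes with \<open>D \<otimes> D\<close> for every diagonal matrix \<open>D\<close>.
\<close>

lemma lin_ext_chi_frt_rel:
  assumes "i \<in> {1..n}" "j \<in> {1..n}" "a \<in> {1..n}" "b \<in> {1..n}"
  shows "lin_ext (chi n d) (frt_rel n r p i j a b) = 0"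
  unfolding lin_ext_frt_rel[OF assms] using assms by auto

text \<open>
  The matrix of \<open>E\<close> in degree two commutes with \<open>R\<close>. The factors \<open>kappa r p (s + 1)\<close> and \<open>kappa r p s\<close> in
  its coproduct are what makes this hold, through \<open>kappa r p i j * kappa r p j i = r\<close> for \<open>i \<noteq> j\<close>.
\<close>

lemma lin_ext_E_frt_rel:
  assumes nz: "r \<noteq> 0" "\<And>i j. 1 \<le> i \<Longrightarrow> i < j \<Longrightarrow> j \<le> n \<Longrightarrow> p i j \<noteq> 0"
    and s: "1 \<le> s" "s < n"
    and ij: "i \<in> {1..n}" "j \<in> {1..n}" "a \<in> {1..n}" "b \<in> {1..n}"
  shows "lin_ext (skew n (kappa r p (s + 1)) (\<lambda>(k, l). if k = s \<and> l = s + 1 then 1 else 0) (kappa r p s))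
      (frt_rel n r p i j a b) = 0"
proof -
  have [simp]: "p s i \<noteq> 0" if "s < i" "i \<le> n" for i
    using nz(2)[of s i] s that by auto
  have [simp]: "p i s \<noteq> 0" if "i < s" "1 \<le> i" for i
    using nz(2)[of i s] s that by auto
  have [simp]: "p (Suc s) i \<noteq> 0" if "Suc s < i" "i \<le> n" for i
    using nz(2)[of "Suc s" i] s that by auto
  have [simp]: "p i (Suc s) \<noteq> 0" if "i < Suc s" "1 \<le> i" for i
    using nz(2)[of i "Suc s"] s that by auto
  show ?thesis
    unfolding lin_ext_frt_rel[OF ij] using ij s nz(1)
    by (auto simp: kappa_def field_simps)
qed

lemma lin_ext_F_frt_rel:
  assumes nz: "r \<noteq> 0" "\<And>i j. 1 \<le> i \<Longrightarrow> i < j \<Longrightarrow> j \<le> n \<Longrightarrow> p i j \<noteq> 0"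
    and s: "1 \<le> s" "s < n"
    and ij: "i \<in> {1..n}" "j \<in> {1..n}" "a \<in> {1..n}" "b \<in> {1..n}"
  shows "lin_ext (skew n (\<lambda>j. inverse (kappa r p j s)) (\<lambda>(k, l). if k = s + 1 \<and> l = s then 1 else 0)
      (\<lambda>j. inverse (kappa r p j (s + 1)))) (frt_rel n r p i j a b) = 0"
proof -
  have [simp]: "p s i \<noteq> 0" if "s < i" "i \<le> n" for i
    using nz(2)[of s i] s that by auto
  have [simp]: "p i s \<noteq> 0" if "i < s" "1 \<le> i" for i
    using nz(2)[of i s] s that by auto
  have [simp]: "p (Suc s) i \<noteq> 0" if "Suc s < i" "i \<le> n" for i
    using nz(2)[of "Suc s" i] s that by auto
  have [simp]: "p i (Suc s) \<noteq> 0" if "i < Suc s" "1 \<le> i" for i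
    using nz(2)[of i "Suc s"] s that by auto
  show ?thesis
    unfolding lin_ext_frt_rel[OF ij] using ij s nz(1)
    by (auto simp: kappa_def field_simps)
qed

context
  fixes n :: nat and r :: "'k::field" and p :: "nat \<Rightarrow> nat \<Rightarrow> 'k"
begin

lemma chi_annih_FRT: "chi n d \<in> annih n (FRT_ideal n r p)"
  unfolding FRT_ideal_def
  by (rule chi_annih_genideal[OF FRT_relations_carrier]) (auto simp: FRT_relations_eq lin_ext_chi_frt_rel)

text \<open>
  The kernel of a character has codimension one, whether or not the values \<open>d\<close> are roots of unity.
\<close>

lemma chi_in_finite_dual: "functional_of n r p (chi n d) \<in> carrier (finite_dual n r p)"
proof -
  let ?I = "{x \<in> carrier (free_ring n). lin_ext (chi n d) x = 0}"
  have I: "ideal ?I (free_ring n)"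
    by (rule ideal_free_ringI)
      (auto simp: free_carrier_add free_carrier_mult free_carrier_single lin_ext_add lin_ext_mult chi_plus)
  have "FRT_ideal n r p \<subseteq> ?I"
    using chi_annih_FRT[of d] ideal_free_ringD(1)[OF FRT_ideal_ideal, of n r p] by (auto simp: annih_def)
  moreover have "\<exists>y. Poly_Mapping.keys y \<subseteq> {0} \<and> x - y \<in> ?I" if "x \<in> carrier (free_ring n)" for x
    by (rule exI[of _ "const (lin_ext (chi n d) x)"])
      (use that in \<open>auto simp: lin_ext_diff free_carrier_diff const_def free_carrier_single\<close>)
  moreover have "chi n d \<in> annih n ?I" by (auto simp: annih_def chi_outside)
  ultimately show ?thesis
    by (intro finite_dual_memI[OF functional_of_in_functionals[OF chi_annih_FRT] I, of "{0}"])
      (auto simp: word_fun_functional_of[OF chi_annih_FRT])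
qed

lemma word_fun_0: "word_fun n r p u 0 = u (\<one>\<^bsub>FRT n r p\<^esub>)"
  by (simp add: word_fun_def proj_one)

lemma word_fun_letter: "word_fun n r p u (Word [(i, j)]) = u (Tcls n r p i j)"
  by (simp add: word_fun_def Tcls_def Tgen_def)

lemma proj_word_plus:
  "v \<in> nwords n \<Longrightarrow> w \<in> nwords n \<Longrightarrow> FRT_proj n r p (Poly_Mapping.single (v + w) 1)
    = FRT_proj n r p (Poly_Mapping.single v 1) \<otimes>\<^bsub>FRT n r p\<^esub> FRT_proj n r p (Poly_Mapping.single w 1)"
  by (simp add: proj_mult free_carrier_single mult_single)

lemma finite_dual_functional: "u \<in> carrier (finite_dual n r p) \<Longrightarrow> u \<in> functionals n r p"
  by (simp add: finite_dual_def)

lemma grouplike_chi: "grouplike n r p (functional_of n r p (chi n d))"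
  unfolding grouplike_def
  by (auto simp: chi_in_finite_dual carrier_FRT proj_mult proj_one functional_of_proj[OF chi_annih_FRT]
      free_carrier_mult lin_ext_mult chi_plus)

text \<open>
  Multiplicativity determines a group-like functional by its values on the generators.
\<close>

lemma grouplike_the:
  "(THE u. grouplike n r p u \<and> (\<forall>j\<in>{1..n}. \<forall>l\<in>{1..n}. u (Tcls n r p j l) = (if j = l then d j else 0)))
    = functional_of n r p (chi n d)"
proof (rule the_equality)
  have "functional_of n r p (chi n d) (Tcls n r p j l) = (if j = l then d j else 0)" if "j \<in> {1..n}"
      "l \<in> {1..n}" for j l
    using that by (simp add: word_fun_functional_of[OF chi_annih_FRT] flip: word_fun_letter)
  then show "grouplike n r p (functional_of n r p (chi n d)) \<and>
      (\<forall>j\<in>{1..n}. \<forall>l\<in>{1..n}. functional_of n r p (chi n d) (Tcls n r p j l) = (if j = l then d j else 0))"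
    by (simp add: grouplike_chi)
next
  fix u assume u: "grouplike n r p u \<and> (\<forall>j\<in>{1..n}. \<forall>l\<in>{1..n}. u (Tcls n r p j l) = (if j = l then d j else 0))"
  have "word_fun n r p u (Word w) = chi n d (Word w)" if "Word w \<in> nwords n" for w
    using that
  proof (induction w)
    case Nil
    then show ?case using u word_fun_0[of u] by (simp add: grouplike_def Word_Nil)
  next
    case (Cons x w)
    obtain i j where x: "x = (i, j)" by force
    have "word_fun n r p u (Word (x # w)) = word_fun n r p u (Word [x]) * word_fun n r p u (Word w)"
      using u Cons.prems unfolding Word_Cons[of x w] word_fun_def
      by (subst proj_word_plus) (auto simp: grouplike_def x proj_in_carrier free_carrier_single)
    then show ?case using Cons u by (auto simp: x word_fun_letter)
  qed
  then have "word_fun n r p u w = chi n d w" if "w \<in> nwords n" for w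
    using that by (metis word.collapse)
  moreover have "u \<in> functionals n r p" using u by (auto simp: grouplike_def finite_dual_functional)
  ultimately show "u = functional_of n r p (chi n d)"
    by (intro functional_eqI[of _ n r p] functional_of_in_functionals chi_annih_FRT)
        (simp_all add: word_fun_functional_of[OF chi_annih_FRT])
qed

lemma Kelt_eq: "Kelt n r p i = functional_of n r p (chi n (kappa r p i))"
  unfolding Kelt_def by (rule grouplike_the)

lemma Lelt_eq: "Lelt n r p i = functional_of n r p (chi n (\<lambda>j. inverse (kappa r p j i)))"
  unfolding Lelt_def by (rule grouplike_the)

lemma skew_primitive_the:
  assumes S: "skew n d e d' \<in> annih n (FRT_ideal n r p)"
    and dual: "functional_of n r p (skew n d e d') \<in> carrier (finite_dual n r p)"
  shows "(THE u. skew_primitive n r p (functional_of n r p (chi n d)) (functional_of n r p (chi n d')) u \<and>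
     (\<forall>k\<in>{1..n}. \<forall>l\<in>{1..n}. u (Tcls n r p k l) = e (k, l))) = functional_of n r p (skew n d e d')"
proof (rule the_equality)
  have "functional_of n r p (skew n d e d') (Tcls n r p k l) = e (k, l)" for k l
    by (simp add: word_fun_functional_of[OF S] flip: word_fun_letter)
  then show "skew_primitive n r p (functional_of n r p (chi n d)) (functional_of n r p (chi n d'))
      (functional_of n r p (skew n d e d')) \<and>
      (\<forall>k\<in>{1..n}. \<forall>l\<in>{1..n}. functional_of n r p (skew n d e d') (Tcls n r p k l) = e (k, l))"
    by (auto simp: skew_primitive_def dual carrier_FRT proj_mult functional_of_proj[OF S]
        functional_of_proj[OF chi_annih_FRT] free_carrier_mult lin_ext_skew_mult)
next
  fix u assume u: "skew_primitive n r p (functional_of n r p (chi n d)) (functional_of n r p (chi n d')) u \<and>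
      (\<forall>k\<in>{1..n}. \<forall>l\<in>{1..n}. u (Tcls n r p k l) = e (k, l))"
  have plus: "word_fun n r p u (v + w) = chi n d v * word_fun n r p u w + word_fun n r p u v * chi n d' w"
    if "v \<in> nwords n" "w \<in> nwords n" for v w
  proof -
    have "functional_of n r p (chi n d) (FRT_proj n r p (Poly_Mapping.single w 1)) = chi n d w"
      if "w \<in> nwords n" for d w
      using that by (simp add: functional_of_proj[OF chi_annih_FRT] free_carrier_single)
    then show ?thesis
      using u that unfolding word_fun_def
      by (subst proj_word_plus) (auto simp: skew_primitive_def proj_in_carrier free_carrier_single)
  qed
  have "word_fun n r p u (Word w) = skew n d e d' (Word w)" if "Word w \<in> nwords n" for w
    using that
  proof (induction w)
    case Nil
    have "word_fun n r p u 0 = word_fun n r p u 0 + word_fun n r p u 0"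
      using plus[of 0 0] by (simp only: chi_0 mult_1 mult_1_right add_0 nwords_zero)
    then have "word_fun n r p u 0 = 0" by (simp only: add_cancel_right_right)
    then show ?case by (simp add: Word_Nil)
  next
    case (Cons x w)
    obtain i j where x: "x = (i, j)" by force
    have "word_fun n r p u (Word (x # w)) = chi n d (Word [x]) * word_fun n r p u (Word w)
        + word_fun n r p u (Word [x]) * chi n d' (Word w)"
      using Cons.prems unfolding Word_Cons[of x w] by (subst plus) (auto simp: x)
    then show ?case using Cons u by (auto simp: x word_fun_letter)
  qed
  then have "word_fun n r p u w = skew n d e d' w" if "w \<in> nwords n" for w
    using that by (metis word.collapse)
  moreover have "u \<in> functionals n r p" using u by (auto simp: skew_primitive_def finite_dual_functional)
  ultimately show "u = functional_of n r p (skew n d e d')"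
    by (intro functional_eqI[of _ n r p] functional_of_in_functionals S)
        (simp_all add: word_fun_functional_of[OF S])
qed

end

section \<open>Products of diagonal functionals\<close>

definition row_weight :: "(nat \<Rightarrow> 'k::field) \<Rightarrow> (nat \<times> nat) word \<Rightarrow> 'k" where
  "row_weight d w = prod_list (map (\<lambda>(i, j). d i) (letters w))"

text \<open>
  Left multiplication by a diagonal matrix scales the rows. As a consequence, a convolution inverse
  of a diagonal character can be read off without associativity of the convolution.
\<close>

lemma chi_tens_comult:
  fixes \<psi> :: "(nat \<times> nat) word \<Rightarrow> 'k::field"
  assumes "w \<in> nwords n"
  shows "lin_ext (tens (chi n d) \<psi>) (word_comult n w) = row_weight d w * \<psi> w"
proof -
  have "lin_ext (tens (chi n d) \<psi>) (word_comult n (Word w)) = row_weight d (Word w) * \<psi> (Word w)"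
    if "Word w \<in> nwords n" for w
    using that
  proof (induction w arbitrary: \<psi>)
    case Nil
    then show ?case by (simp add: Word_Nil tens_def row_weight_def zero_prod_def)
  next
    case (Cons x w)
    obtain i j where x: "x = (i, j)" by force
    have ij: "i \<in> {1..n}" and w: "Word w \<in> nwords n" using Cons.prems by (simp_all add: x)
    have step: "tens (\<lambda>v. chi n d (Word [(i, k)] + v)) (\<lambda>v. \<psi> (Word [(k, j)] + v))
      = (\<lambda>z. (if i = k then d i else 0) * tens (chi n d) (\<lambda>v. \<psi> (Word [(k, j)] + v)) z)" for k
      using ij by (auto simp: tens_def chi_plus)
    have "lin_ext (tens (chi n d) \<psi>) (word_comult n (Word (x # w)))
       = (\<Sum>k=1..n. if i = k then d i * (row_weight d (Word w) * \<psi> (Word [(k, j)] + Word w)) else 0)"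
      unfolding x lin_ext_word_comult_Cons
      by (intro sum.cong refl) (simp add: step lin_ext_factor_left Cons.IH[OF w])
    also have "\<dots> = d i * (row_weight d (Word w) * \<psi> (Word [(i, j)] + Word w))"
      using ij by (simp add: sum.delta')
    finally show ?case by (simp add: x row_weight_def plus_word_def)
  qed
  from this[of "letters w"] show ?thesis using assms by simp
qed

lemma row_weight_mult_chi: "row_weight d w * chi n d' w = chi n (\<lambda>j. d j * d' j) w"
proof -
  have "row_weight d (Word w) * chi n d' (Word w) = chi n (\<lambda>j. d j * d' j) (Word w)" for w
    by (induction w) (auto simp: row_weight_def chi_def)
  then show ?thesis by (metis word.collapse)
qed

lemma row_weight_nonzero:
  assumes "\<And>j. j \<in> {1..n} \<Longrightarrow> d j \<noteq> 0" "w \<in> nwords n"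
  shows "row_weight d w \<noteq> 0"
  using assms by (cases w) (force simp: row_weight_def nwords_def prod_list_zero_iff)

context
  fixes n :: nat and r :: "'k::field" and p :: "nat \<Rightarrow> nat \<Rightarrow> 'k"
begin

lemma chi_functional: "functional_of n r p (chi n d) \<in> functionals n r p"
  by (rule functional_of_in_functionals[OF chi_annih_FRT])

lemma word_fun_chi: "word_fun n r p (functional_of n r p (chi n d)) = chi n d"
  by (rule word_fun_functional_of[OF chi_annih_FRT])

lemma word_fun_chi_convolution:
  assumes "u \<in> functionals n r p" "w \<in> nwords n"
  shows "word_fun n r p (convolution n r p (functional_of n r p (chi n d)) u) w
      = row_weight d w * word_fun n r p u w"
  using assms by (simp add: word_fun_convolution chi_functional word_fun_chi chi_tens_comult)

lemma chi_convolution: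
  "convolution n r p (functional_of n r p (chi n d)) (functional_of n r p (chi n d'))
   = functional_of n r p (chi n (\<lambda>j. d j * d' j))"
  by (rule functional_eqI[OF convolution_in_functionals])
    (simp_all add: chi_functional word_fun_chi_convolution word_fun_chi row_weight_mult_chi)

lemma FRT_counit_eq: "FRT_counit n r p = functional_of n r p (chi n (\<lambda>_. 1))"
proof
  fix a
  have "free_counit x = lin_ext (chi n (\<lambda>_. 1)) x" if "x \<in> carrier (free_ring n)" for x :: "'k free"
  proof -
    have "prod_list (map (\<lambda>(i, j). if i = j then 1 else 0) (letters w)) = chi n (\<lambda>_. 1::'k) w" if
        "w \<in> nwords n" for w
      unfolding chi_def using that by (intro arg_cong[where f = prod_list] map_cong) (auto simp: nwords_def)
    then show ?thesis
      using that unfolding free_counit_def free_lift_def lin_ext_def carrier_free_ring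
      by (intro sum.cong) auto
  qed
  then show "FRT_counit n r p a = functional_of n r p (chi n (\<lambda>_. 1)) a"
    using coset_rep_carrier(1)[of a n r p] by (simp add: FRT_counit_def functional_of_def)
qed

lemma finite_dual_inv_chi:
  assumes d: "\<And>j. j \<in> {1..n} \<Longrightarrow> d j \<noteq> 0"
  shows "inv\<^bsub>finite_dual n r p\<^esub> functional_of n r p (chi n d) = functional_of n r p (chi n (\<lambda>j. inverse (d j)))"
proof -
  have chi_cong: "chi n f = chi n g" if "\<And>j. j \<in> {1..n} \<Longrightarrow> f j = g j" for f g :: "nat \<Rightarrow> 'k"
    unfolding chi_def using that by (intro ext arg_cong[where f = prod_list] map_cong) auto
  have one: "chi n (\<lambda>j. d j * inverse (d j)) = chi n (\<lambda>_. 1)" "chi n (\<lambda>j. inverse (d j) * d j) = chi n (\<lambda>_. 1)"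
    using d by (auto intro!: chi_cong)
  show ?thesis
    unfolding m_inv_def
  proof (rule the_equality)
    show "functional_of n r p (chi n (\<lambda>j. inverse (d j))) \<in> carrier (finite_dual n r p) \<and>
      functional_of n r p (chi n d) \<otimes>\<^bsub>finite_dual n r p\<^esub> functional_of n r p (chi n (\<lambda>j. inverse
          (d j))) = \<one>\<^bsub>finite_dual n r p\<^esub> \<and>
      functional_of n r p (chi n (\<lambda>j. inverse (d j))) \<otimes>\<^bsub>finite_dual n r p\<^esub> functional_of n r p
          (chi n d) = \<one>\<^bsub>finite_dual n r p\<^esub>"
      by (simp add: chi_in_finite_dual) (simp add: finite_dual_def chi_convolution one FRT_counit_eq)
  next
    fix y assume y: "y \<in> carrier (finite_dual n r p) \<and>
      functional_of n r p (chi n d) \<otimes>\<^bsub>finite_dual n r p\<^esub> y = \<one>\<^bsub>finite_dual n r p\<^esub> \<and>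
      y \<otimes>\<^bsub>finite_dual n r p\<^esub> functional_of n r p (chi n d) = \<one>\<^bsub>finite_dual n r p\<^esub>"
    then have yf: "y \<in> functionals n r p" by (simp add: finite_dual_functional)
    have "convolution n r p (functional_of n r p (chi n d)) y
        = functional_of n r p (chi n (\<lambda>j. d j * inverse (d j)))"
      using y by (simp add: one FRT_counit_eq) (simp add: finite_dual_def FRT_counit_eq)
    then have eq: "row_weight d w * word_fun n r p y w = row_weight d w * chi n (\<lambda>j. inverse (d j)) w"
        if "w \<in> nwords n" for w
      using word_fun_chi_convolution[OF yf that, of d] by (simp add: word_fun_chi row_weight_mult_chi)
    have nz: "row_weight d w \<noteq> 0" if "w \<in> nwords n" for w
      by (rule row_weight_nonzero[OF _ that]) (rule d)
    have "word_fun n r p y w = chi n (\<lambda>j. inverse (d j)) w" if "w \<in> nwords n" for w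
      using eq[OF that] nz[OF that] by simp
    then show "y = functional_of n r p (chi n (\<lambda>j. inverse (d j)))"
      by (intro functional_eqI[OF yf chi_functional]) (simp_all add: word_fun_chi)
  qed
qed

end

section \<open>Finite dimension forces roots of unity\<close>

lemma sum_fun_scale: "(\<Sum>v\<in>t. fun_scale (c v) v) a = (\<Sum>v\<in>t. c v * v a)"
  by (induction t rule: infinite_finite_induct) (auto simp: fun_scale_def)

lemma vandermonde:
  fixes x :: "'i \<Rightarrow> 'k::field"
  assumes M: "finite M" "inj_on x M" and eq: "\<And>d::nat. (\<Sum>m\<in>M. c m * x m ^ d) = 0" and m: "m \<in> M"
  shows "c m = 0"
proof -
  have poly: "(\<Sum>m\<in>M. c m * poly P (x m)) = 0" for P
  proof -
    have "(\<Sum>m\<in>M. c m * poly P (x m)) = (\<Sum>m\<in>M. \<Sum>d\<le>Polynomial.degree P. Polynomial.coeff P d * (c m * x m ^ d))"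
      by (simp add: poly_altdef sum_distrib_left mult_ac)
    also have "\<dots> = (\<Sum>d\<le>Polynomial.degree P. Polynomial.coeff P d * (\<Sum>m\<in>M. c m * x m ^ d))"
      by (subst sum.swap) (simp add: sum_distrib_left)
    finally show ?thesis by (simp add: eq)
  qed
  \<comment> \<open>The polynomial that isolates the node of index m.\<close>
  let ?P = "\<Prod>k\<in>M - {m}. [:- x k, 1:]"
  have "poly ?P (x k) = 0" if "k \<in> M - {m}" for k
    using that M(1) by (auto simp: poly_prod prod_zero_iff)
  then have "(\<Sum>k\<in>M. c k * poly ?P (x k)) = c m * poly ?P (x m)"
    using M(1) m by (subst sum.remove[of M m]) auto
  moreover have "poly ?P (x m) \<noteq> 0"
    using M m by (auto simp: poly_prod prod_zero_iff inj_on_def)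
  ultimately show ?thesis using poly[of ?P] by simp
qed

text \<open>
  A relation among the \<open>u m\<close>, evaluated at \<open>a 0, a 1, \<dots>\<close>, is a relation among the columns of a
  Vandermonde matrix with the distinct nodes \<open>x m\<close>.
\<close>

lemma powers_not_in_finite_span:
  fixes u :: "nat \<Rightarrow> 'a \<Rightarrow> 'k::field"
  assumes x: "inj x" and u: "\<And>m d. u m (a d) = x m ^ d" and B: "finite B" "range u \<subseteq> fun_span B"
  shows False
proof -
  have inj: "inj u"
  proof (rule injI)
    fix k m assume "u k = u m"
    then have "x k = x m" using u[of k 1] u[of m 1] by simp
    then show "k = m" using x by (simp add: inj_eq)
  qed
  have "fun_space.independent (range u)"
    unfolding fun_space.independent_explicit_module
  proof (intro allI impI)
    fix t c v assume t: "finite t" "t \<subseteq> range u" "(\<Sum>v\<in>t. fun_scale (c v) v) = 0" "v \<in> t"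
    obtain M where M: "t = u ` M" by (meson subset_imageE t(2))
    have injM: "inj_on u M" using inj by (rule inj_on_subset) simp
    have fin: "finite M" using t(1) by (simp add: M finite_image_iff injM)
    obtain m where m: "m \<in> M" "v = u m" using t(4) M by blast
    have "(\<Sum>k\<in>M. c (u k) * x k ^ d) = 0" for d
    proof -
      have "(\<Sum>k\<in>M. c (u k) * u k (a d)) = (\<Sum>v\<in>t. c v * v (a d))"
        unfolding M by (subst sum.reindex) (simp_all add: injM)
      also have "\<dots> = 0" using t(3) sum_fun_scale[of c t "a d"] by simp
      finally show ?thesis by (simp add: u)
    qed
    then show "c v = 0"
      unfolding m(2) by (intro vandermonde[of M x "\<lambda>k. c (u k)"]) (use fin m(1) inj_on_subset[OF x] in auto)
  qed
  then have "finite (range u)"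
    using fun_space.independent_span_bound[OF B(1) _ B(2)] by blast
  then show False using inj by (simp add: finite_image_iff)
qed

lemma finite_dimensional_imp_kappa_root:
  fixes r :: "'k::field"
  assumes fd: "finite_dimensional (U_alg n r p)" and ij: "i \<in> {1..n}" "j \<in> {1..n}"
    and nz: "kappa r p i j \<noteq> 0"
  shows "is_root_of_unity (kappa r p i j)"
proof (rule ccontr)
  assume nr: "\<not> is_root_of_unity (kappa r p i j)"
  define u where "u m = functional_of n r p (chi n (\<lambda>l. kappa r p i l ^ m))" for m
  have conv: "convolution n r p (Kelt n r p i) (u m) = u (Suc m)" for m
    by (simp add: u_def Kelt_eq chi_convolution)
  have "u m \<in> V" if V: "subring V (finite_dual n r p)" "U_generators n r p \<subseteq> V" for V m
  proof (induction m)
    case 0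
    then show ?case
      using submonoid.one_closed[OF subring.axioms(2)[OF V(1)]]
      by (simp add: finite_dual_def FRT_counit_eq u_def)
  next
    case (Suc m)
    have "Kelt n r p i \<in> V" using V(2) ij by (auto simp: U_generators_def)
    then have "Kelt n r p i \<otimes>\<^bsub>finite_dual n r p\<^esub> u m \<in> V"
      using Suc submonoid.m_closed[OF subring.axioms(2)[OF V(1)]] by blast
    then show ?case by (simp add: finite_dual_def conv)
  qed
  then have "range u \<subseteq> U_alg n r p" by (auto simp: U_alg_def)
  then obtain B where B: "finite B" "range u \<subseteq> fun_span B"
    using fd by (auto simp: finite_dimensional_def)
  have "inj (\<lambda>m. kappa r p i j ^ m)"
  proof (rule linorder_injI)
    fix k m :: nat assume km: "k < m"
    have "kappa r p i j ^ m = kappa r p i j ^ k * kappa r p i j ^ (m - k)"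
      using km by (simp flip: power_add)
    then show "kappa r p i j ^ k \<noteq> kappa r p i j ^ m"
      using nr nz km by (auto simp: is_root_of_unity_def dest!: spec[of _ "m - k"])
  qed
  moreover have "u m (FRT_proj n r p (Poly_Mapping.single (Word (replicate d (j, j))) 1))
      = (kappa r p i j ^ m) ^ d" for m d
  proof -
    have "u m (FRT_proj n r p (Poly_Mapping.single (Word (replicate d (j, j))) 1))
        = word_fun n r p (u m) (Word (replicate d (j, j)))"
      by (simp add: word_fun_def)
    also have "\<dots> = chi n (\<lambda>l. kappa r p i l ^ m) (Word (replicate d (j, j)))"
      by (simp add: u_def word_fun_chi)
    also have "\<dots> = (kappa r p i j ^ m) ^ d"
      using ij by (induction d) auto
    finally show ?thesis .
  qed
  ultimately show False using B by (rule powers_not_in_finite_span)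
qed

section \<open>Straightening words modulo the FRT relations\<close>

lemma frt_rel_mem:
  "FRT_relations n r p \<subseteq> I \<Longrightarrow> i \<in> {1..n} \<Longrightarrow> j \<in> {1..n} \<Longrightarrow> a \<in> {1..n} \<Longrightarrow> b \<in> {1..n} \<Longrightarrow>
    frt_rel n r p i j a b \<in> I"
  unfolding FRT_relations_eq by blast

lemma eq_by_lin_ext:
  fixes x y :: "'m \<Rightarrow>\<^sub>0 'k::comm_ring_1"
  assumes "\<And>\<phi>. lin_ext \<phi> x = lin_ext \<phi> y"
  shows "x = y"
proof (rule poly_mapping_eqI)
  have "lin_ext (\<lambda>v. if v = w then 1 else 0) z = Poly_Mapping.lookup z w" for w and z :: "'m \<Rightarrow>\<^sub>0 'k"
    by (auto simp: lin_ext_def in_keys_iff if_distrib cong: if_cong)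
  then show "Poly_Mapping.lookup x w = Poly_Mapping.lookup y w" for w
    using assms by metis
qed

definition letter_less :: "((nat \<times> nat) \<times> (nat \<times> nat)) set" where
  "letter_less = less_than <*lex*> less_than"

lemma letter_less_iff: "((i, a), (j, b)) \<in> letter_less \<longleftrightarrow> i < j \<or> i = j \<and> a < b"
  by (simp add: letter_less_def)

lemma wf_letter_less: "wf letter_less"
  unfolding letter_less_def by (intro wf_lex_prod wf_less_than)

text \<open>
  If the rows of \<open>x\<close> and \<open>y\<close> differ, the relation expresses their product by two words that start
  in the smaller row; within one row the two generators commute up to a scalar.
\<close>

lemma letter_descent:
  fixes I :: "'k::field free set"
  assumes I: "ideal I (free_ring n)" "FRT_relations n r p \<subseteq> I"
    and nz: "\<And>i j. i \<in> {1..n} \<Longrightarrow> j \<in> {1..n} \<Longrightarrow> kappa r p i j \<noteq> 0"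
    and xy: "x \<in> {1..n} \<times> {1..n}" "y \<in> {1..n} \<times> {1..n}" "(y, x) \<in> letter_less"
  obtains x1 y1 x2 y2 \<alpha> \<beta> where
    "{x1, y1, x2, y2} \<subseteq> {1..n} \<times> {1..n}" "(x1, x) \<in> letter_less" "(x2, x) \<in> letter_less"
    "Poly_Mapping.single (Word [x, y]) 1
      - (Poly_Mapping.single (Word [x1, y1]) \<alpha> + Poly_Mapping.single (Word [x2, y2]) \<beta>) \<in> I"
proof -
  obtain j a i b where x: "x = (j, a)" and y: "y = (i, b)" by (meson surj_pair)
  have ran: "i \<in> {1..n}" "j \<in> {1..n}" "a \<in> {1..n}" "b \<in> {1..n}" using xy by (auto simp: x y)
  let ?k = "kappa r p"
  have rel: "frt_rel n r p i j a b \<in> I" by (rule frt_rel_mem[OF I(2) ran])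
  consider "i < j" | "i = j" "b < a" using xy(3) by (auto simp: x y letter_less_iff)
  then show ?thesis
  proof cases
    case 1
    define \<alpha> where "\<alpha> = inverse (?k i j) * ?k b a"
    define \<beta> where "\<beta> = inverse (?k i j) * (if b < a then r - 1 else 0)"
    have "const (inverse (?k i j)) * frt_rel n r p i j a b = Poly_Mapping.single (Word [x, y]) 1
      - (Poly_Mapping.single (Word [(i, b), (j, a)]) \<alpha> + Poly_Mapping.single (Word [(i, a), (j, b)]) \<beta>)"
      using 1 nz[OF ran(1,2)]
      by (intro eq_by_lin_ext)
        (simp add: lin_ext_const_mult lin_ext_frt_rel[OF ran] lin_ext_diff lin_ext_add \<alpha>_def \<beta>_def x y
            field_simps)
    moreover have "const (inverse (?k i j)) * frt_rel n r p i j a b \<in> I"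
      by (rule ideal_free_ringD(6)[OF I(1) rel]) simp
    ultimately show ?thesis
      using 1 ran by (intro that[of "(i, b)" "(j, a)" "(i, a)" "(j, b)" \<alpha> \<beta>]) (auto simp: x y letter_less_iff)
  next
    case 2
    have "frt_rel n r p i j a b = Poly_Mapping.single (Word [x, y]) 1
      - (Poly_Mapping.single (Word [(i, b), (j, a)]) (?k b a) + Poly_Mapping.single (Word [(i, b), (j, a)]) 0)"
      by (intro eq_by_lin_ext, unfold lin_ext_frt_rel[OF ran])
        (use 2 in \<open>simp add: lin_ext_diff lin_ext_add x y kappa_def algebra_simps\<close>)
    then show ?thesis
      using 2 ran rel by (intro that[of "(i, b)" "(j, a)" "(i, b)" "(j, a)" "?k b a" 0])
          (auto simp: x y letter_less_iff)
  qed
qed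

text \<open>
  In a sorted word equal letters are adjacent, so each letter occurs fewer than \<open>N\<close> times.
\<close>

lemma sorted_length_bound:
  fixes A :: "(nat \<times> nat) set"
  assumes "sorted_wrt (\<lambda>x y. (y, x) \<notin> letter_less) w" "finite A" "set w \<subseteq> A" "0 < N"
    and "\<And>g u v. w \<noteq> u @ replicate N g @ v"
  shows "length w \<le> card A * N"
  using assms
proof (induction w arbitrary: A rule: length_induct)
  case (1 w)
  note sorted = 1(2) and A = 1(3,4) and N = 1(5) and no = 1(6)
  show ?case
  proof (cases w)
    case (Cons g w')
    define m where "m = length (takeWhile (\<lambda>x. x = g) w)"
    define d where "d = dropWhile (\<lambda>x. x = g) w"
    have "takeWhile (\<lambda>x. x = g) w = replicate m g"
      unfolding m_def by (rule replicate_eqI) (auto dest: set_takeWhileD)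
    then have w: "w = replicate m g @ d"
      using takeWhile_dropWhile_id[of "\<lambda>x. x = g" w] by (simp add: d_def)
    have "m < N"
    proof (rule ccontr)
      assume "\<not> m < N"
      then have "replicate m g = replicate N g @ replicate (m - N) g"
        by (simp flip: replicate_add)
      then have "w = [] @ replicate N g @ (replicate (m - N) g @ d)"
        by (simp add: w)
      then show False using no by blast
    qed
    have "0 < m" using Cons by (simp add: m_def)
    have sd: "sorted_wrt (\<lambda>x y. (y, x) \<notin> letter_less) d"
      using sorted by (simp add: w sorted_wrt_append)
    have "g \<notin> set d"
    proof
      assume g: "g \<in> set d"
      then obtain h d' where d: "d = h # d'" by (cases d) auto
      have h: "h \<noteq> g"
        using d unfolding d_def dropWhile_eq_Cons_conv by blast
      have "(g, h) \<notin> letter_less" using sd g h by (auto simp: d)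
      moreover have "(h, g) \<notin> letter_less"
        using sorted \<open>0 < m\<close> by (auto simp: w d sorted_wrt_append)
      ultimately show False using h by (cases g; cases h) (auto simp: letter_less_iff)
    qed
    then have "set d \<subseteq> A - {g}" using A(2) by (auto simp: w)
    moreover have "length d < length w" using \<open>0 < m\<close> by (simp add: w)
    moreover have "d \<noteq> u @ replicate N h @ v" for u h v
      using no[of "replicate m g @ u" h v] by (simp add: w)
    ultimately have "length d \<le> card (A - {g}) * N"
      using 1(1) sd A(1) N by (metis finite_Diff)
    moreover have "card A = Suc (card (A - {g}))"
      using A Cons by (intro card.remove) auto
    moreover have "length w = m + length d" by (simp add: w)
    ultimately show ?thesis using \<open>m < N\<close> by simp
  qed simp
qed

text \<open>
  Straightening terminates because sorting a descent decreases the word lexicographically and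
  removing an \<open>N\<close>-th power shortens it; both decrease the well-founded order \<open>lenlex\<close>.
\<close>

lemma finite_spanning_words:
  fixes I :: "'k::field free set"
  assumes I: "ideal I (free_ring n)" "FRT_relations n r p \<subseteq> I"
    and nz: "\<And>i j. i \<in> {1..n} \<Longrightarrow> j \<in> {1..n} \<Longrightarrow> kappa r p i j \<noteq> 0"
    and N: "0 < N" and pow: "\<And>i j. i \<in> {1..n} \<Longrightarrow> j \<in> {1..n} \<Longrightarrow> \<exists>c. Tgen i j ^ N - const c \<in> I"
  obtains A where "finite A" "A \<subseteq> nwords n"
    "\<And>x. x \<in> carrier (free_ring n) \<Longrightarrow> \<exists>y. Poly_Mapping.keys y \<subseteq> A \<and> x - y \<in> I"
proof -
  note D = ideal_free_ringD[OF I(1)]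
  let ?L = "{1..n} \<times> {1..n}"
  define M where "M = card ?L * N"
  define A where "A = Word ` {w. set w \<subseteq> ?L \<and> length w \<le> M}"
  define red where "red x \<longleftrightarrow> (\<exists>y. Poly_Mapping.keys y \<subseteq> A \<and> x - y \<in> I)" for x :: "'k free"
  have "finite A" unfolding A_def by (intro finite_imageI finite_lists_length_le) simp
  have red_add: "red (x + y)" if xy: "red x" "red y" for x y
  proof -
    obtain x' y' where "Poly_Mapping.keys x' \<subseteq> A" "x - x' \<in> I" "Poly_Mapping.keys y' \<subseteq> A" "y - y' \<in> I"
      using xy unfolding red_def by blast
    then have "Poly_Mapping.keys (x' + y') \<subseteq> A" "(x + y) - (x' + y') \<in> I"
      using keys_add[of x' y'] D(3)[of "x - x'" "y - y'"] by (auto simp: algebra_simps)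
    then show ?thesis by (auto simp: red_def)
  qed
  have red_cong: "red x" if y: "red y" and xy: "x - y \<in> I" for x y
  proof -
    obtain y' where "Poly_Mapping.keys y' \<subseteq> A" "y - y' \<in> I" using y by (auto simp: red_def)
    then show ?thesis using D(3)[OF xy, of "y - y'"] by (auto simp: red_def)
  qed
  have red_word: "\<forall>c. red (Poly_Mapping.single (Word w) c)" if "set w \<subseteq> ?L" for w
    using wf_lenlex[OF wf_letter_less] that
  proof (induction w rule: wf_induct_rule)
    case (less w)
    have surround: "Poly_Mapping.single (Word u) c * (z :: 'k free) * Poly_Mapping.single (Word v) 1 \<in> I"
      if "z \<in> I" "set u \<subseteq> ?L" "set v \<subseteq> ?L" for u v c z
      using that by (intro D(6,7) free_carrier_single) (auto simp: nwords_def)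
    have "transp (\<lambda>x y. (y, x) \<notin> letter_less)"
      by (auto simp: transp_def letter_less_iff)
    then have "sorted_wrt (\<lambda>x y. (y, x) \<notin> letter_less) w \<or> (\<exists>k. Suc k < length w
        \<and> (w ! Suc k, w ! k) \<in> letter_less)"
      using sorted_wrt_iff_nth_Suc_transp by blast
    moreover have "length w \<le> M" if "sorted_wrt (\<lambda>x y. (y, x) \<notin> letter_less) w"
        "\<And>g u v. w \<noteq> u @ replicate N g @ v"
      unfolding M_def by (rule sorted_length_bound[OF that(1) _ less.prems N that(2)]) simp
    ultimately consider "length w \<le> M"
      | k where "Suc k < length w" "(w ! Suc k, w ! k) \<in> letter_less"
      | g u v where "w = u @ replicate N g @ v"
      by blast
    then show ?case
    proof cases
      case 1
      then have "Word w \<in> A" using less.prems by (auto simp: A_def)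
      then have "Poly_Mapping.keys (Poly_Mapping.single (Word w) c) \<subseteq> A" for c :: 'k by simp
      then show ?thesis using D(2) unfolding red_def by (metis diff_self)
    next
      case 2
      define u x y v where "u = take k w" and "x = w ! k" and "y = w ! Suc k" and "v = drop (Suc (Suc k)) w"
      have w: "w = u @ [x, y] @ v"
        using 2(1) by (simp add: u_def x_def y_def v_def Cons_nth_drop_Suc id_take_nth_drop[symmetric])
      have mem: "x \<in> ?L" "y \<in> ?L" "set u \<subseteq> ?L" "set v \<subseteq> ?L" using less.prems w by auto
      obtain x1 y1 x2 y2 \<alpha> \<beta> where xy: "{x1, y1, x2, y2} \<subseteq> ?L" "(x1, x) \<in> letter_less" "(x2, x) \<in> letter_less"
        and z: "Poly_Mapping.single (Word [x, y]) 1
          - (Poly_Mapping.single (Word [x1, y1]) \<alpha> + Poly_Mapping.single (Word [x2, y2]) \<beta>) \<in> I"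
        using letter_descent[OF I nz mem(1,2)] 2(2) unfolding x_def y_def by metis
      have smaller: "\<forall>c. red (Poly_Mapping.single (Word (u @ [x', y'] @ v)) c)"
        if "{x', y'} \<subseteq> ?L" "(x', x) \<in> letter_less" for x' y'
      proof (rule less.IH)
        show "(u @ [x', y'] @ v, w) \<in> lenlex letter_less"
          using lex_append_leftI[of "x' # y' # v" "x # y # v" letter_less u] that(2)
          by (simp add: w lenlex_conv)
      qed (use that mem in auto)
      show ?thesis
      proof
        fix c
        let ?s = "Poly_Mapping.single (Word (u @ [x1, y1] @ v)) (c * \<alpha>) + Poly_Mapping.single (Word
            (u @ [x2, y2] @ v)) (c * \<beta>)"
        have "Poly_Mapping.single (Word w) c - ?s \<in> I"
          using surround[OF z mem(3,4), of c]
          by (simp add: w right_diff_distrib left_diff_distrib distrib_left distrib_right mult_single Word_plus)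
        moreover have "red ?s" using smaller xy by (intro red_add) auto
        ultimately show "red (Poly_Mapping.single (Word w) c)" by (rule red_cong[rotated])
      qed
    next
      case 3
      have mem: "g \<in> ?L" "set u \<subseteq> ?L" "set v \<subseteq> ?L" using less.prems 3 N by auto
      obtain i j where g: "g = (i, j)" by force
      obtain d where d: "Tgen i j ^ N - const d \<in> I" using pow mem(1) g by blast
      have T: "Tgen i j ^ N = Poly_Mapping.single (Word (replicate N g)) (1::'k)"
        by (induction N) (simp_all add: Word_Nil Tgen_def g mult_single Word_plus flip: single_one)
      have shorter: "\<forall>c. red (Poly_Mapping.single (Word (u @ v)) c)"
      proof (rule less.IH)
        show "(u @ v, w) \<in> lenlex letter_less" using N by (simp add: 3 lenlex_conv)
      qed (use mem in auto)
      show ?thesis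
      proof
        fix c
        have "Poly_Mapping.single (Word w) c - Poly_Mapping.single (Word (u @ v)) (c * d) \<in> I"
          using surround[OF d mem(2,3), of c] unfolding T const_def
          by (simp add: 3 right_diff_distrib left_diff_distrib mult_single Word_plus)
        then show "red (Poly_Mapping.single (Word w) c)" using shorter red_cong by blast
      qed
    qed
  qed
  have "red x" if "x \<in> carrier (free_ring n)" for x
  proof (rule monomial_induct[where A = "nwords n"])
    show "Poly_Mapping.keys x \<subseteq> nwords n" using that by (simp add: carrier_free_ring)
    show "red 0" unfolding red_def using D(2) by (intro exI[of _ 0]) simp
    show "red (Poly_Mapping.single w c)" if "w \<in> nwords n" for w c
      using red_word[of "letters w"] that by (simp add: nwords_def)
  qed (rule red_add)
  moreover have "A \<subseteq> nwords n" by (auto simp: A_def nwords_def)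
  ultimately show ?thesis
    using that[OF \<open>finite A\<close>] unfolding red_def by blast
qed


section \<open>The ideal of powers\<close>

text \<open>
  The off-diagonal exponent is the order \<open>l\<close> of \<open>r\<close> and not \<open>N\<close>, because the q-binomial theorem
  produces the cross terms \<open>(T i k)\<^sup>l \<otimes> (T k j)\<^sup>l\<close>, which have to lie in the ideal already.
\<close>

definition power_generators :: "nat \<Rightarrow> nat \<Rightarrow> nat \<Rightarrow> 'k::field free set" where
  "power_generators n l N = {Tgen i j ^ l | i j. i \<in> {1..n} \<and> j \<in> {1..n} \<and> i \<noteq> j}
     \<union> {Tgen i i ^ N - 1 | i. i \<in> {1..n}}"

definition power_ideal :: "nat \<Rightarrow> 'k::field \<Rightarrow> (nat \<Rightarrow> nat \<Rightarrow> 'k) \<Rightarrow> nat \<Rightarrow> nat \<Rightarrow> 'k free set" where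
  "power_ideal n r p l N = Idl\<^bsub>free_ring n\<^esub> (FRT_relations n r p \<union> power_generators n l N)"

lemma power_generators_carrier: "FRT_relations n r p \<union> power_generators n l N \<subseteq> carrier (free_ring n)"
  using FRT_relations_carrier[of n r p]
  by (auto simp: power_generators_def intro!: free_carrier_power free_carrier_Tgen free_carrier_diff)

lemma power_ideal_ideal: "ideal (power_ideal n r p l N) (free_ring n)"
  unfolding power_ideal_def by (rule ring.genideal_ideal[OF ring_free_ring power_generators_carrier])

lemma power_ideal_sub: "FRT_relations n r p \<union> power_generators n l N \<subseteq> power_ideal n r p l N"
  unfolding power_ideal_def by (rule ring.genideal_self[OF ring_free_ring power_generators_carrier])

lemma Tgen_power: "Tgen i j ^ m = Poly_Mapping.single (Word (replicate m (i, j))) (1::'k::field)"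
  by (induction m) (simp_all add: Word_Nil Tgen_def mult_single Word_plus flip: single_one)

lemma pair_power:
  "Poly_Mapping.single (Word [g], Word [h]) (1::'k::comm_ring_1) ^ m
    = Poly_Mapping.single (Word (replicate m g), Word (replicate m h)) 1"
  by (induction m) (simp_all add: Word_Nil mult_single Word_plus zero_prod_def[symmetric])

text \<open>
  Moving \<open>T i m\<close> past \<open>T i k\<close> within a row costs \<open>kappa r p k m\<close>, and moving \<open>T m j\<close> past \<open>T k j\<close> within a column costs
  \<open>kappa r p m k\<close>. The product of the two factors is \<open>r\<close>, independently of \<open>p\<close>.
\<close>

lemma tensor_letters_q_commute:
  fixes I :: "'k::field free set"
  assumes I: "FRT_relations n r p \<subseteq> I"
    and nz: "\<And>i j. i \<in> {1..n} \<Longrightarrow> j \<in> {1..n} \<Longrightarrow> kappa r p i j \<noteq> 0"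
    and ij: "i \<in> {1..n}" "j \<in> {1..n}" and km: "1 \<le> k" "k < m" "m \<le> n"
  shows "Poly_Mapping.single (Word [(i, m)], Word [(m, j)]) 1 * Poly_Mapping.single
      (Word [(i, k)], Word [(k, j)]) 1
     - const r * (Poly_Mapping.single (Word [(i, k)], Word [(k, j)]) 1 * Poly_Mapping.single
         (Word [(i, m)], Word [(m, j)]) 1)
     \<in> tens_annih n I"
  unfolding tens_annih_def
proof (intro CollectI ballI)
  fix \<phi> \<psi> assume \<phi>: "\<phi> \<in> annih n I" and \<psi>: "\<psi> \<in> annih n I"
  have ran: "k \<in> {1..n}" "m \<in> {1..n}" using km by auto
  have "frt_rel n r p i i k m \<in> I" "frt_rel n r p k m j j \<in> I"
    using frt_rel_mem[OF I] ij ran by blast+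
  then have "lin_ext \<phi> (frt_rel n r p i i k m) = 0" "lin_ext \<psi> (frt_rel n r p k m j j) = 0"
    using \<phi> \<psi> by (auto simp: annih_def)
  then have 1: "kappa r p m k * \<phi> (Word [(i, m), (i, k)]) = r * \<phi> (Word [(i, k), (i, m)])"
    and 2: "kappa r p k m * \<psi> (Word [(m, j), (k, j)]) = r * \<psi> (Word [(k, j), (m, j)])"
    using km unfolding lin_ext_frt_rel[OF ij(1) ij(1) ran] lin_ext_frt_rel[OF ran ij(2) ij(2)]
    by (simp_all add: kappa_def)
  have "r \<noteq> 0" using nz[OF ij(1) ij(1)] by (simp add: kappa_def)
  have kk: "kappa r p m k * kappa r p k m = r"
    using nz[OF ran] km by (simp add: kappa_def)
  have "r * (\<phi> (Word [(i, m), (i, k)]) * \<psi> (Word [(m, j), (k, j)]))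
    = (kappa r p m k * \<phi> (Word [(i, m), (i, k)])) * (kappa r p k m * \<psi> (Word [(m, j), (k, j)]))"
    using arg_cong[OF kk, of "\<lambda>c. c * (\<phi> (Word [(i, m), (i, k)]) * \<psi> (Word [(m, j), (k, j)]))"]
    by (simp only: mult_ac)
  also have "\<dots> = r * (r * (\<phi> (Word [(i, k), (i, m)]) * \<psi> (Word [(k, j), (m, j)])))"
    unfolding 1 2 by (simp add: mult_ac)
  finally have "\<phi> (Word [(i, m), (i, k)]) * \<psi> (Word [(m, j), (k, j)])
     = r * (\<phi> (Word [(i, k), (i, m)]) * \<psi> (Word [(k, j), (m, j)]))"
    using \<open>r \<noteq> 0\<close> by simp
  then show "lin_ext (tens \<phi> \<psi>) (Poly_Mapping.single (Word [(i, m)], Word [(m, j)]) 1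
      * Poly_Mapping.single (Word [(i, k)], Word [(k, j)]) 1
     - const r * (Poly_Mapping.single (Word [(i, k)], Word [(k, j)]) 1 * Poly_Mapping.single
         (Word [(i, m)], Word [(m, j)]) 1)) = 0"
    by (simp add: mult_single const_mult_single lin_ext_diff Word_plus tens_def)
qed

text \<open>
  For the diagonal generators, the \<open>l\<close>-th power of the coproduct is congruent to the single term
  \<open>(T i i)\<^sup>l \<otimes> (T i i)\<^sup>l\<close>; raising this to the power \<open>N div l\<close> gives \<open>(T i i)\<^sup>N \<otimes> (T i i)\<^sup>N\<close>, which is congruent to \<open>1\<close>.
\<close>

lemma power_ideal_coideal:
  fixes r :: "'k::field"
  assumes nz: "\<And>i j. i \<in> {1..n} \<Longrightarrow> j \<in> {1..n} \<Longrightarrow> kappa r p i j \<noteq> 0"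
    and l: "0 < l" "r ^ l = 1" "\<And>m. 0 < m \<Longrightarrow> m < l \<Longrightarrow> r ^ m \<noteq> 1" "l dvd N"
    and x: "x \<in> power_ideal n r p l N"
  shows "free_comult n x \<in> tens_annih n (power_ideal n r p l N)"
proof -
  let ?I = "power_ideal n r p l N" and ?B = "tens_annih n (power_ideal n r p l N)"
  interpret T: two_sided_ideal ?B by (rule tens_annih_two_sided[OF power_ideal_ideal])
  have rel: "FRT_relations n r p \<subseteq> ?I" and gen: "power_generators n l N \<subseteq> ?I"
    using power_ideal_sub[of n r p l N] by auto
  define X where "X i j k = (Poly_Mapping.single (Word [(i, k)], Word [(k, j)]) 1 :: (nat \<times> nat) word \<times>
      (nat \<times> nat) word \<Rightarrow>\<^sub>0 'k)" for i j k
  have frob: "T.eqv (free_comult n (Tgen i j ^ l)) (\<Sum>k=1..n. X i j k ^ l)" if "i \<in> {1..n}" "j \<in> {1..n}" for i j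
    unfolding free_comult_power free_comult_Tgen X_def[symmetric]
  proof (rule T.q_frobenius_sum[where \<iota> = const
      and q = r, OF const_add const_mult const_1 const_0 const_commute _ l(1,2,3)])
    show "T.eqv (X i j m * X i j k) (const r * (X i j k * X i j m))" if "1 \<le> k" "k < m" "m \<le> n" for k m
      unfolding T.eqv_def X_def using tensor_letters_q_commute[OF rel nz \<open>i \<in> _\<close> \<open>j \<in> _\<close> that] .
  qed
  have off: "\<phi> (Word (replicate l (i, j))) = 0" if "\<phi> \<in> annih n ?I" "i \<in> {1..n}" "j \<in> {1..n}" "i \<noteq> j" for \<phi> i j
  proof -
    have "Tgen i j ^ l \<in> ?I" using gen that by (auto simp: power_generators_def)
    then have "lin_ext \<phi> (Tgen i j ^ l) = 0" using that by (auto simp: annih_def)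
    then show ?thesis by (simp add: Tgen_power)
  qed
  have X_pow: "X i j k ^ m = Poly_Mapping.single (Word (replicate m (i, k)), Word (replicate m
      (k, j))) 1" for i j k m
    by (simp add: X_def pair_power)
  have Xoff: "T.eqv (X i j k ^ l) 0" if "i \<in> {1..n}" "j \<in> {1..n}" "k \<in> {1..n}" "i \<noteq> k \<or> k \<noteq> j" for i j k
  proof -
    have "X i j k ^ l \<in> ?B"
      unfolding X_pow tens_annih_def using off that by (auto simp: tens_def)
    then show ?thesis by (simp only: T.eqv_0_iff)
  qed
  have "free_comult n g \<in> ?B" if "g \<in> FRT_relations n r p \<union> power_generators n l N" for g
    using that unfolding power_generators_def
  proof (elim UnE CollectE exE conjE)
    assume "g \<in> FRT_relations n r p"
    then show ?thesis using frt_rel_comult[OF rel] unfolding FRT_relations_eq by blast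
  next
    fix i j assume g: "g = Tgen i j ^ l" and ij: "i \<in> {1..n}" "j \<in> {1..n}" "i \<noteq> j"
    have "T.eqv (\<Sum>k=1..n. X i j k ^ l) (\<Sum>k=1..n. 0)"
      using ij by (intro T.eqv_sum Xoff) auto
    then have "T.eqv (free_comult n g) 0"
      using T.eqv_trans[OF frob[OF ij(1,2)]] g by simp
    then show ?thesis by (simp add: T.eqv_0_iff)
  next
    fix i assume g: "g = Tgen i i ^ N - 1" and i: "i \<in> {1..n}"
    obtain q where q: "N = l * q" using l(4) by auto
    have "(\<Sum>k=1..n. X i i k ^ l) = X i i i ^ l + (\<Sum>k\<in>{1..n} - {i}. X i i k ^ l)"
      using i by (simp add: sum.remove)
    also have "T.eqv \<dots> (X i i i ^ l + (\<Sum>k\<in>{1..n} - {i}. 0))"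
      using i by (intro T.eqv_add T.eqv_refl T.eqv_sum Xoff) auto
    finally have "T.eqv (free_comult n (Tgen i i ^ l)) (X i i i ^ l)"
      using T.eqv_trans[OF frob[OF i i]] by simp
    then have "T.eqv (free_comult n (Tgen i i ^ l) ^ q) ((X i i i ^ l) ^ q)"
      by (rule T.eqv_power)
    then have "T.eqv (free_comult n (Tgen i i ^ N)) (X i i i ^ N)"
      by (simp add: q power_mult free_comult_power)
    also have "T.eqv (X i i i ^ N) 1"
    proof -
      have unit: "\<phi> (Word (replicate N (i, i))) = \<phi> 0" if "\<phi> \<in> annih n ?I" for \<phi>
      proof -
        have "Tgen i i ^ N - 1 \<in> ?I" using gen i by (auto simp: power_generators_def)
        then have "lin_ext \<phi> (Tgen i i ^ N - 1) = 0" using that by (auto simp: annih_def)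
        then show ?thesis by (simp add: Tgen_power lin_ext_diff)
      qed
      have "X i i i ^ N - 1 \<in> ?B"
        unfolding X_pow tens_annih_def
      proof (intro CollectI ballI)
        fix \<phi> \<psi> assume "\<phi> \<in> annih n ?I" "\<psi> \<in> annih n ?I"
        then show "lin_ext (tens \<phi> \<psi>) (Poly_Mapping.single (Word (replicate N (i, i)), Word (replicate N
            (i, i))) 1 - 1) = 0"
          using unit[of \<phi>] unit[of \<psi>] by (simp add: tens_def lin_ext_diff zero_prod_def)
      qed
      then show ?thesis by (simp only: T.eqv_def)
    qed
    finally show ?thesis by (simp add: g free_comult_diff T.eqv_def)
  qed
  then show ?thesis
    by (rule coideal_genideal[OF power_generators_carrier power_ideal_def _ x])
qed

lemma lin_ext_chi_Tgen: "i \<in> {1..n} \<Longrightarrow> lin_ext (chi n d) (Tgen i j) = (if i = j then d i else 0)"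
  by (simp add: Tgen_def)

lemma lin_ext_skew_Tgen: "lin_ext (skew n d e d') (Tgen i j) = e (i, j)"
  by (simp add: Tgen_def)

lemma lin_ext_chi_power: "lin_ext (chi n d) (x ^ m) = lin_ext (chi n d) x ^ m"
  by (induction m) (simp_all add: lin_ext_mult chi_plus)

lemma chi_power_generators:
  assumes "0 < l" "\<And>j. j \<in> {1..n} \<Longrightarrow> d j ^ N = 1" "g \<in> power_generators n l N"
  shows "lin_ext (chi n d) g = 0"
  using assms by (auto simp: power_generators_def lin_ext_diff lin_ext_chi_power lin_ext_chi_Tgen)

text \<open>
  Both characters in the coproduct vanish on an off-diagonal generator \<open>x\<close>, so each term in the
  expansion of the value at \<open>x\<^sup>l\<close> contains a vanishing factor once \<open>l \<ge> 2\<close>.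
\<close>

lemma skew_power_generators:
  assumes "2 \<le> l" "\<And>j. e (j, j) = 0" "g \<in> power_generators n l N"
  shows "lin_ext (skew n d e d') g = 0"
  using assms(3) unfolding power_generators_def
proof (elim UnE CollectE exE conjE)
  fix i j assume g: "g = Tgen i j ^ l" and ij: "i \<in> {1..n}" "j \<in> {1..n}" "i \<noteq> j"
  obtain m where "l = Suc (Suc m)" using assms(1) by (metis add_2_eq_Suc le_Suc_ex)
  then show ?thesis
    using ij by (simp add: g lin_ext_skew_mult lin_ext_mult chi_plus lin_ext_chi_Tgen)
next
  fix i assume g: "g = Tgen i i ^ N - 1" and i: "i \<in> {1..n}"
  have "lin_ext (skew n d e d') (Tgen i i ^ m) = 0" for m
    by (induction m) (simp_all add: lin_ext_skew_mult lin_ext_skew_Tgen assms(2))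
  then show ?thesis by (simp add: g lin_ext_diff)
qed

section \<open>Roots of unity force finite dimension\<close>

text \<open>
  Restriction to \<open>S\<close> embeds the space into the span of the finitely many indicator functions of points
  of \<open>S\<close>.
\<close>

lemma finite_dimensional_restrict:
  fixes U :: "('a \<Rightarrow> 'k::field) set"
  assumes U: "fun_space.subspace U" and S: "finite S"
    and inj: "\<And>u. u \<in> U \<Longrightarrow> (\<And>a. a \<in> S \<Longrightarrow> u a = 0) \<Longrightarrow> u = 0"
  shows "finite_dimensional U"
proof -
  define \<rho> :: "('a \<Rightarrow> 'k) \<Rightarrow> 'a \<Rightarrow> 'k" where "\<rho> u a = (if a \<in> S then u a else 0)" for u a
  interpret L: Vector_Spaces.linear fun_scale fun_scale \<rho>
    by unfold_locales (auto simp: \<rho>_def fun_scale_def fun_eq_iff)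
  obtain B where B: "B \<subseteq> U" "fun_space.independent B" "U \<subseteq> fun_span B"
    using fun_space.maximal_independent_subset .
  have span: "fun_span B = U"
    using B(1,3) fun_space.span_minimal[OF B(1) U] by blast
  have injB: "inj_on \<rho> (fun_span B)"
    unfolding L.inj_on_iff_eq_0[OF fun_space.subspace_span] unfolding span
  proof (intro ballI impI)
    fix u assume "u \<in> U" "\<rho> u = 0"
    then show "u = 0"
      by (intro inj) (auto simp: \<rho>_def fun_eq_iff split: if_splits)
  qed
  define \<delta> :: "'a \<Rightarrow> 'a \<Rightarrow> 'k" where "\<delta> s a = (if a = s then 1 else 0)" for s a
  have "\<rho> u \<in> fun_span (\<delta> ` S)" for u
  proof -
    have "\<rho> u = (\<Sum>s\<in>S. fun_scale (u s) (\<delta> s))"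
    proof
      fix a
      have "(\<Sum>s\<in>T. fun_scale (u s) (\<delta> s)) a = (\<Sum>s\<in>T. if s = a then u s else 0)" if "finite T" for T
        using that by (induction T) (auto simp: fun_scale_def \<delta>_def)
      then show "\<rho> u a = (\<Sum>s\<in>S. fun_scale (u s) (\<delta> s)) a"
        using S by (simp add: \<rho>_def)
    qed
    then show ?thesis
      by (auto intro!: fun_space.span_sum fun_space.span_scale intro: fun_space.span_base)
  qed
  moreover have "fun_space.independent (\<rho> ` B)"
    by (rule L.independent_injective_image[OF B(2) injB[unfolded fun_span_def]])
  ultimately have "finite (\<rho> ` B)"
    using fun_space.independent_span_bound[of "\<delta> ` S" "\<rho> ` B"] S by auto
  moreover have "inj_on \<rho> B" using injB by (rule inj_on_subset) (rule fun_space.span_superset)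
  ultimately have "finite B" by (simp add: finite_image_iff)
  then show ?thesis using span unfolding finite_dimensional_def by blast
qed

context
  fixes n :: nat and r :: "'k::field" and p :: "nat \<Rightarrow> nat \<Rightarrow> 'k" and l N :: nat
  assumes kappa_nz: "\<And>i j. i \<in> {1..n} \<Longrightarrow> j \<in> {1..n} \<Longrightarrow> kappa r p i j \<noteq> 0"
    and l: "2 \<le> l" "r ^ l = 1" "\<And>m. 0 < m \<Longrightarrow> m < l \<Longrightarrow> r ^ m \<noteq> 1"
    and N: "0 < N" "l dvd N" "\<And>i j. i \<in> {1..n} \<Longrightarrow> j \<in> {1..n} \<Longrightarrow> kappa r p i j ^ N = 1"
begin

abbreviation (input) "I \<equiv> power_ideal n r p l N"

definition vanishing_functionals :: "('k free set \<Rightarrow> 'k) set" where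
  "vanishing_functionals = {u \<in> functionals n r p. word_fun n r p u \<in> annih n I}"

lemma FRT_ideal_sub_power_ideal: "FRT_ideal n r p \<subseteq> I"
  using FRT_ideal_subset[OF power_ideal_ideal] power_ideal_sub by blast

lemma power_ideal_finite_codim:
  "\<exists>A. finite A \<and> A \<subseteq> nwords n \<and>
    (\<forall>x\<in>carrier (free_ring n). \<exists>y. Poly_Mapping.keys y \<subseteq> A \<and> x - y \<in> I)"
proof -
  have rel: "FRT_relations n r p \<subseteq> I" using power_ideal_sub by blast
  have gen: "power_generators n l N \<subseteq> I" using power_ideal_sub by blast
  have pow: "\<exists>c. Tgen i j ^ N - const c \<in> I" if ij: "i \<in> {1..n}" "j \<in> {1..n}" for i j
  proof (cases "i = j")
    case True
    then have "Tgen i j ^ N - const 1 \<in> I" using gen ij by (auto simp: power_generators_def)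
    then show ?thesis by blast
  next
    case False
    obtain m where m: "N = l * Suc m" using N(1,2) by (metis dvdE gr0_implies_Suc mult_is_0 not_gr0)
    have "Tgen i j ^ l \<in> I" using gen ij False by (auto simp: power_generators_def)
    then have "Tgen i j ^ l * Tgen i j ^ (l * m) \<in> I"
      using ij by (intro ideal_free_ringD(7)[OF power_ideal_ideal] free_carrier_power free_carrier_Tgen)
    then have "Tgen i j ^ N - const 0 \<in> I" by (simp add: m power_add)
    then show ?thesis by blast
  qed
  show ?thesis
    using finite_spanning_words[OF power_ideal_ideal rel kappa_nz N(1) pow] by metis
qed

lemma vanishing_in_finite_dual: "vanishing_functionals \<subseteq> carrier (finite_dual n r p)"
proof -
  obtain A where "finite A" "A \<subseteq> nwords n"
    "\<And>x. x \<in> carrier (free_ring n) \<Longrightarrow> \<exists>y. Poly_Mapping.keys y \<subseteq> A \<and> x - y \<in> I"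
    using power_ideal_finite_codim by blast
  then show ?thesis
    using finite_dual_memI[OF _ power_ideal_ideal FRT_ideal_sub_power_ideal]
    by (auto simp: vanishing_functionals_def)
qed

lemma annih_anti: "J \<subseteq> J' \<Longrightarrow> annih n J' \<subseteq> annih n J"
  by (auto simp: annih_def)

lemma functional_of_vanishing: "\<phi> \<in> annih n I \<Longrightarrow> functional_of n r p \<phi> \<in> vanishing_functionals"
  using annih_anti[OF FRT_ideal_sub_power_ideal]
  by (auto simp: vanishing_functionals_def functional_of_in_functionals word_fun_functional_of)

lemma vanishing_iff:
  assumes "u \<in> functionals n r p"
  shows "u \<in> vanishing_functionals \<longleftrightarrow> (\<forall>x\<in>I. u (FRT_proj n r p x) = 0)"
proof -
  have "u (FRT_proj n r p x) = lin_ext (word_fun n r p u) x" if "x \<in> I" for x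
    using functional_proj[OF assms] that ideal_free_ringD(1)[OF power_ideal_ideal] by blast
  then show ?thesis
    using assms word_fun_annih[OF assms] by (auto simp: vanishing_functionals_def annih_def)
qed

lemma functionals_closed:
  "0 \<in> functionals n r p"
  "u \<in> functionals n r p \<Longrightarrow> v \<in> functionals n r p \<Longrightarrow> u + v \<in> functionals n r p"
  "u \<in> functionals n r p \<Longrightarrow> fun_scale c u \<in> functionals n r p"
  by (auto simp: functionals_def fun_scale_def algebra_simps)

lemma vanishing_closed:
  "0 \<in> vanishing_functionals"
  "u \<in> vanishing_functionals \<Longrightarrow> v \<in> vanishing_functionals \<Longrightarrow> u + v \<in> vanishing_functionals"
  "u \<in> vanishing_functionals \<Longrightarrow> fun_scale c u \<in> vanishing_functionals"
proof -
  have f: "u \<in> functionals n r p" if "u \<in> vanishing_functionals" for u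
    using that by (simp add: vanishing_functionals_def)
  show "0 \<in> vanishing_functionals"
    using vanishing_iff[OF functionals_closed(1)] by simp
  show "u + v \<in> vanishing_functionals" if "u \<in> vanishing_functionals" "v \<in> vanishing_functionals"
    using that vanishing_iff[OF f[OF that(1)]] vanishing_iff[OF f[OF that(2)]]
      vanishing_iff[OF functionals_closed(2)[OF f[OF that(1)] f[OF that(2)]]] by simp
  show "fun_scale c u \<in> vanishing_functionals" if "u \<in> vanishing_functionals"
    using that f vanishing_iff[OF f[OF that]] vanishing_iff[OF functionals_closed(3)[OF f[OF that]]] by
        (simp add: fun_scale_def)
qed

lemma vanishing_convolution:
  assumes "u \<in> vanishing_functionals" "v \<in> vanishing_functionals"
  shows "convolution n r p u v \<in> vanishing_functionals"
proof -
  have f: "u \<in> functionals n r p" "v \<in> functionals n r p" and a: "word_fun n r p u \<in> annih n I"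
      "word_fun n r p v \<in> annih n I"
    using assms by (auto simp: vanishing_functionals_def)
  have "convolution n r p u v (FRT_proj n r p x) = 0" if "x \<in> I" for x
  proof -
    have "x \<in> carrier (free_ring n)" using that ideal_free_ringD(1)[OF power_ideal_ideal] by blast
    moreover have "free_comult n x \<in> tens_annih n I"
      by (rule power_ideal_coideal[OF kappa_nz _ l(2,3) N(2) that]) (use l(1) in auto)
    ultimately show ?thesis using a by (simp add: convolution_proj[OF f] tens_annih_def)
  qed
  then show ?thesis by (simp add: vanishing_iff[OF convolution_in_functionals[OF f]])
qed

lemma FRT_power_gens:
  "g \<in> FRT_relations n r p \<union> power_generators n l N \<Longrightarrow> (\<And>j. j \<in> {1..n} \<Longrightarrow> d j ^ N = 1) \<Longrightarrow> lin_ext (chi n d) g = 0"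
  using chi_power_generators[of l n d N g] l(1) lin_ext_chi_frt_rel[of _ n _ _ _ d r p]
  by (auto simp: FRT_relations_eq)

lemma chi_vanishing:
  assumes "\<And>j. j \<in> {1..n} \<Longrightarrow> d j ^ N = 1"
  shows "functional_of n r p (chi n d) \<in> vanishing_functionals"
  unfolding power_ideal_def
  by (rule functional_of_vanishing, unfold power_ideal_def, rule chi_annih_genideal[OF
      power_generators_carrier])
    (rule FRT_power_gens, use assms in auto)

lemma skew_vanishing:
  assumes d: "\<And>j. j \<in> {1..n} \<Longrightarrow> d j ^ N = 1" and d': "\<And>j. j \<in> {1..n} \<Longrightarrow> d' j ^ N = 1"
    and e: "\<And>x. x \<notin> {1..n} \<times> {1..n} \<Longrightarrow> e x = 0" "\<And>j. e (j, j) = 0"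
    and rel: "\<And>i j a b. i \<in> {1..n} \<Longrightarrow> j \<in> {1..n} \<Longrightarrow> a \<in> {1..n} \<Longrightarrow> b \<in> {1..n} \<Longrightarrow>
      lin_ext (skew n d e d') (frt_rel n r p i j a b) = 0"
  shows "(THE u. skew_primitive n r p (functional_of n r p (chi n d)) (functional_of n r p (chi n d')) u \<and>
     (\<forall>k\<in>{1..n}. \<forall>m\<in>{1..n}. u (Tcls n r p k m) = e (k, m))) \<in> vanishing_functionals"
proof -
  have "lin_ext (skew n d e d') g = 0" if "g \<in> FRT_relations n r p \<union> power_generators n l N" for g
    using that rel skew_power_generators[of l e g n N d d', OF l(1) e(2)] by (auto simp: FRT_relations_eq)
  then have S: "skew n d e d' \<in> annih n I"
    unfolding power_ideal_def
    by (intro skew_annih_genideal[OF power_generators_carrier] FRT_power_gens d d' e(1))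
  then have "functional_of n r p (skew n d e d') \<in> vanishing_functionals"
    by (rule functional_of_vanishing)
  moreover from this have "functional_of n r p (skew n d e d') \<in> carrier (finite_dual n r p)"
    using vanishing_in_finite_dual by blast
  moreover have "skew n d e d' \<in> annih n (FRT_ideal n r p)"
    using S annih_anti[OF FRT_ideal_sub_power_ideal] by blast
  ultimately show ?thesis by (simp only: skew_primitive_the)
qed

lemma kappa_inverse_power: "i \<in> {1..n} \<Longrightarrow> j \<in> {1..n} \<Longrightarrow> inverse (kappa r p i j) ^ N = 1"
  using N(3) by (simp add: power_inverse)

lemma subring_vanishing: "subring vanishing_functionals (finite_dual n r p)"
proof (rule subring.intro)
  have uminus: "- u \<in> vanishing_functionals" if "u \<in> vanishing_functionals" for u
    using vanishing_closed(3)[OF that, of "-1"] by (simp add: fun_scale_def fun_Compl_def)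
  have inv: "inv\<^bsub>add_monoid (finite_dual n r p)\<^esub> u = - u" if "u \<in> vanishing_functionals" for u
    unfolding m_inv_def
  proof (rule the_equality)
    show "- u \<in> carrier (add_monoid (finite_dual n r p)) \<and>
      u \<otimes>\<^bsub>add_monoid (finite_dual n r p)\<^esub> - u = \<one>\<^bsub>add_monoid (finite_dual n r p)\<^esub> \<and>
      - u \<otimes>\<^bsub>add_monoid (finite_dual n r p)\<^esub> u = \<one>\<^bsub>add_monoid (finite_dual n r p)\<^esub>"
      using subsetD[OF vanishing_in_finite_dual uminus[OF that]] by (simp add: finite_dual_def)
  next
    fix y assume "y \<in> carrier (add_monoid (finite_dual n r p)) \<and>
      u \<otimes>\<^bsub>add_monoid (finite_dual n r p)\<^esub> y = \<one>\<^bsub>add_monoid (finite_dual n r p)\<^esub> \<and>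
      y \<otimes>\<^bsub>add_monoid (finite_dual n r p)\<^esub> u = \<one>\<^bsub>add_monoid (finite_dual n r p)\<^esub>"
    then have "y + u = 0" by (simp add: finite_dual_def)
    then show "y = - u" by (simp add: eq_neg_iff_add_eq_0)
  qed
  show "subgroup vanishing_functionals (add_monoid (finite_dual n r p))"
    using vanishing_in_finite_dual vanishing_closed uminus inv
    by (intro subgroup.intro) (simp_all, simp_all add: finite_dual_def)
  show "submonoid vanishing_functionals (finite_dual n r p)"
  proof (rule submonoid.intro)
    show "\<one>\<^bsub>finite_dual n r p\<^esub> \<in> vanishing_functionals"
      using chi_vanishing[of "\<lambda>_. 1"] by (simp add: finite_dual_def FRT_counit_eq)
    show "u \<otimes>\<^bsub>finite_dual n r p\<^esub> v \<in> vanishing_functionals"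
      if "u \<in> vanishing_functionals" "v \<in> vanishing_functionals" for u v
      using vanishing_convolution[OF that] by (simp add: finite_dual_def)
  qed (rule vanishing_in_finite_dual)
qed

lemma U_generators_vanishing: "U_generators n r p \<subseteq> vanishing_functionals"
proof -
  have r0: "r \<noteq> 0" using l by (auto simp: power_0_left)
  have p: "p i j \<noteq> 0" if "1 \<le> i" "i < j" "j \<le> n" for i j
    using kappa_nz[of i j] that by (simp add: kappa_def)
  have K: "Kelt n r p i \<in> vanishing_functionals" "inv\<^bsub>finite_dual n r p\<^esub> Kelt n r p i \<in> vanishing_functionals"
    if "i \<in> {1..n}" for i
  proof -
    show "Kelt n r p i \<in> vanishing_functionals"
      unfolding Kelt_eq by (rule chi_vanishing) (rule N(3)[OF that])
    have "inv\<^bsub>finite_dual n r p\<^esub> Kelt n r p i = functional_of n r p (chi n (\<lambda>j. inverse (kappa r p i j)))"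
      unfolding Kelt_eq by (rule finite_dual_inv_chi) (rule kappa_nz[OF that])
    moreover have "functional_of n r p (chi n (\<lambda>j. inverse (kappa r p i j))) \<in> vanishing_functionals"
      by (rule chi_vanishing) (rule kappa_inverse_power[OF that])
    ultimately show "inv\<^bsub>finite_dual n r p\<^esub> Kelt n r p i \<in> vanishing_functionals" by simp
  qed
  have L: "Lelt n r p i \<in> vanishing_functionals" "inv\<^bsub>finite_dual n r p\<^esub> Lelt n r p i \<in> vanishing_functionals"
    if "i \<in> {1..n}" for i
  proof -
    show "Lelt n r p i \<in> vanishing_functionals"
      unfolding Lelt_eq by (rule chi_vanishing) (rule kappa_inverse_power[OF _ that])
    have "inv\<^bsub>finite_dual n r p\<^esub> Lelt n r p i
        = functional_of n r p (chi n (\<lambda>j. inverse (inverse (kappa r p j i))))"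
      unfolding Lelt_eq by (rule finite_dual_inv_chi) (use kappa_nz that in simp)
    then show "inv\<^bsub>finite_dual n r p\<^esub> Lelt n r p i \<in> vanishing_functionals"
      using chi_vanishing[of "\<lambda>j. kappa r p j i"] N(3) that by simp
  qed
  have E: "Eelt n r p i \<in> vanishing_functionals" if "i \<in> {1..<n}" for i
  proof -
    have i: "1 \<le> i" "i < n" using that by auto
    let ?e = "\<lambda>(k, l). if k = i \<and> l = i + 1 then 1 else 0 :: 'k"
    have "(THE u. skew_primitive n r p (functional_of n r p (chi n (kappa r p (i + 1))))
        (functional_of n r p (chi n (kappa r p i))) u \<and>
      (\<forall>k\<in>{1..n}. \<forall>l\<in>{1..n}. u (Tcls n r p k l) = ?e (k, l))) \<in> vanishing_functionals"
      by (rule skew_vanishing[OF N(3) N(3) _ _ lin_ext_E_frt_rel[OF r0 p i]]) (use i in \<open>auto split: if_splits\<close>)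
    then show ?thesis unfolding Eelt_def Kelt_eq by (simp only: split_conv)
  qed
  have F: "Felt n r p i \<in> vanishing_functionals" if "i \<in> {1..<n}" for i
  proof -
    have i: "1 \<le> i" "i < n" using that by auto
    let ?e = "\<lambda>(k, l). if k = i + 1 \<and> l = i then 1 else 0 :: 'k"
    have "(THE u. skew_primitive n r p (functional_of n r p (chi n (\<lambda>j. inverse (kappa r p j i))))
        (functional_of n r p (chi n (\<lambda>j. inverse (kappa r p j (i + 1))))) u \<and>
      (\<forall>k\<in>{1..n}. \<forall>l\<in>{1..n}. u (Tcls n r p k l) = ?e (k, l))) \<in> vanishing_functionals"
      by (rule skew_vanishing[OF kappa_inverse_power kappa_inverse_power _ _ lin_ext_F_frt_rel[OF r0 p
          i]]) (use i in \<open>auto split: if_splits\<close>)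
    then show ?thesis unfolding Felt_def Lelt_eq by (simp only: split_conv)
  qed
  show ?thesis unfolding U_generators_def using K L E F by blast
qed

text \<open>
  A functional that vanishes on the ideal is determined by its values on a finite set of words that
  spans modulo the ideal.
\<close>

lemma finite_dimensional_U: "finite_dimensional (U_alg n r p)"
proof -
  have sub: "U_alg n r p \<subseteq> vanishing_functionals"
    unfolding U_alg_def using subring_vanishing U_generators_vanishing vanishing_closed(3) by blast
  have ss: "fun_space.subspace (U_alg n r p)"
  proof (rule fun_space.subspaceI)
    show "0 \<in> U_alg n r p"
      unfolding U_alg_def using subgroup.one_closed[OF subring.axioms(1)]
      by (fastforce simp: finite_dual_def)
    show "u + v \<in> U_alg n r p" if "u \<in> U_alg n r p" "v \<in> U_alg n r p" for u v
      unfolding U_alg_def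
    proof (intro InterI, elim CollectE conjE)
      fix V assume V: "subring V (finite_dual n r p)" "\<forall>c. \<forall>u\<in>V. fun_scale c u \<in> V" "U_generators n r p \<subseteq> V"
      then have "u \<in> V" "v \<in> V" using that by (auto simp: U_alg_def)
      then show "u + v \<in> V"
        using subgroup.m_closed[OF subring.axioms(1)[OF V(1)], of u v] by (simp add: finite_dual_def)
    qed
    show "fun_scale c u \<in> U_alg n r p" if "u \<in> U_alg n r p" for c u
      using that by (auto simp: U_alg_def)
  qed
  obtain A where A: "finite A" "A \<subseteq> nwords n"
    "\<And>x. x \<in> carrier (free_ring n) \<Longrightarrow> \<exists>y. Poly_Mapping.keys y \<subseteq> A \<and> x - y \<in> I"
    using power_ideal_finite_codim by blast
  show ?thesis
  proof (rule finite_dimensional_restrict[OF ss])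
    show "finite ((\<lambda>w. FRT_proj n r p (Poly_Mapping.single w 1)) ` A)" using A(1) by simp
    fix u assume "u \<in> U_alg n r p"
      and zero: "\<And>a. a \<in> (\<lambda>w. FRT_proj n r p (Poly_Mapping.single w 1)) ` A \<Longrightarrow> u a = 0"
    then have u: "u \<in> functionals n r p" "word_fun n r p u \<in> annih n I"
      using sub by (auto simp: vanishing_functionals_def)
    have wA: "word_fun n r p u w = 0" if "w \<in> A" for w
      using zero that by (simp add: word_fun_def)
    have "word_fun n r p u w = 0" if w: "w \<in> nwords n" for w
    proof -
      obtain y where y: "Poly_Mapping.keys y \<subseteq> A" "Poly_Mapping.single w 1 - y \<in> I"
        using A(3)[OF free_carrier_single[OF w]] by blast
      have "lin_ext (word_fun n r p u) y = 0"
        unfolding lin_ext_def by (rule sum.neutral) (use wA y(1) in auto)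
      moreover have "lin_ext (word_fun n r p u) (Poly_Mapping.single w 1 - y) = 0"
        using u(2) y(2) by (simp add: annih_def)
      ultimately show ?thesis by (simp add: lin_ext_diff)
    qed
    then show "u = 0"
      by (intro functional_eqI[OF u(1) functionals_closed(1)]) (simp add: word_fun_def)
  qed
qed

end

lemma is_root_of_unity_inverse: "is_root_of_unity x \<Longrightarrow> is_root_of_unity (inverse x)"
  by (auto simp: is_root_of_unity_def power_inverse)

lemma is_root_of_unity_mult:
  assumes "is_root_of_unity x" "is_root_of_unity y" shows "is_root_of_unity (x * y)"
proof -
  obtain a b where "0 < a" "x ^ a = 1" "0 < b" "y ^ b = 1" using assms by (auto simp: is_root_of_unity_def)
  then have "0 < a * b" "(x * y) ^ (a * b) = 1"
    by (simp_all add: power_mult_distrib power_mult, metis power_mult power_one mult.commute)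
  then show ?thesis unfolding is_root_of_unity_def by blast
qed

lemma common_exponent:
  assumes "finite A" "\<And>x. x \<in> A \<Longrightarrow> is_root_of_unity x"
  obtains N where "0 < N" "\<And>x. x \<in> A \<Longrightarrow> x ^ N = 1"
proof -
  have "\<exists>N>0. \<forall>x\<in>A. x ^ N = 1"
    using assms
  proof (induction A)
    case (insert x A)
    then obtain N where N: "0 < N" "\<forall>x\<in>A. x ^ N = 1" by blast
    obtain a where a: "0 < a" "x ^ a = 1"
      using insert.prems[of x] by (auto simp: is_root_of_unity_def)
    note aN = a N
    have "y ^ (a * N) = 1" if "y \<in> insert x A" for y
      using that aN by (auto simp: power_mult) (metis mult.commute power_mult power_one)
    then show ?case using aN by (intro exI[of _ "a * N"]) auto
  qed auto
  then show ?thesis using that by blast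
qed

theorem mainTheorem1:
  fixes n :: nat
    and r :: "'k::{alg_closed_field, field_char_0}"
    and p :: "nat \<Rightarrow> nat \<Rightarrow> 'k"
  assumes "n \<ge> 2"
    and "r \<noteq> 0"
    and "r \<noteq> 1"
    and "\<And>i j. 1 \<le> i \<Longrightarrow> i < j \<Longrightarrow> j \<le> n \<Longrightarrow> p i j \<noteq> 0"
  shows "finite_dimensional (U_alg n r p) \<longleftrightarrow>
    is_root_of_unity r \<and>
    (\<forall>i j. 1 \<le> i \<and> i < j \<and> j \<le> n \<longrightarrow> is_root_of_unity (r / p i j))"
proof
  have nz: "kappa r p i j \<noteq> 0" if "i \<in> {1..n}" "j \<in> {1..n}" for i j
    using that assms(2,4) by (auto simp: kappa_def)
  {
    assume "finite_dimensional (U_alg n r p)"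
    then have root: "is_root_of_unity (kappa r p i j)" if "i \<in> {1..n}" "j \<in> {1..n}" for i j
      using that nz by (intro finite_dimensional_imp_kappa_root)
    have "is_root_of_unity r" using root[of 1 1] assms(1) by (simp add: kappa_def)
    moreover have "is_root_of_unity (r / p i j)" if "1 \<le> i" "i < j" "j \<le> n" for i j
      using root[of j i] that by (simp add: kappa_def)
    ultimately show "is_root_of_unity r \<and> (\<forall>i j. 1 \<le> i \<and> i < j \<and> j \<le> n \<longrightarrow> is_root_of_unity (r / p i j))"
      by blast
  }
  {
    assume roots: "is_root_of_unity r \<and> (\<forall>i j. 1 \<le> i \<and> i < j \<and> j \<le> n \<longrightarrow> is_root_of_unity (r / p i j))"
    have kroot: "is_root_of_unity (kappa r p i j)" if ij: "i \<in> {1..n}" "j \<in> {1..n}" for i j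
    proof (cases "i < j")
      case True
      then have "is_root_of_unity (r * inverse (r / p i j))"
        using roots ij by (intro is_root_of_unity_mult is_root_of_unity_inverse) auto
      then show ?thesis using True assms(2) by (simp add: kappa_def)
    next
      case False
      then show ?thesis using roots ij by (auto simp: kappa_def)
    qed
    obtain N where N: "0 < N" "\<And>x. x \<in> (\<lambda>(i, j). kappa r p i j) ` ({1..n} \<times> {1..n}) \<Longrightarrow> x ^ N = 1"
      by (rule common_exponent[of "(\<lambda>(i, j). kappa r p i j) ` ({1..n} \<times> {1..n})"]) (use kroot in auto)
    have kN: "kappa r p i j ^ N = 1" if "i \<in> {1..n}" "j \<in> {1..n}" for i j
      using that by (intro N(2)) auto
    define l where "l = (LEAST m. 0 < m \<and> r ^ m = 1)"
    have ex: "\<exists>m. 0 < m \<and> r ^ m = 1" using roots by (auto simp: is_root_of_unity_def)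
    have l: "0 < l" "r ^ l = 1" unfolding l_def using LeastI_ex[OF ex] by auto
    have min: "r ^ m \<noteq> 1" if "0 < m" "m < l" for m
      using not_less_Least[of m "\<lambda>m. 0 < m \<and> r ^ m = 1"] that unfolding l_def by auto
    have "2 \<le> l" using l assms(3) by (cases "l = 1") auto
    have "r ^ (N mod l) = 1"
    proof -
      have "r ^ N = 1" using kN[of 1 1] assms(1) by (simp add: kappa_def)
      moreover have "r ^ N = (r ^ l) ^ (N div l) * r ^ (N mod l)"
        by (metis mult_div_mod_eq power_add power_mult)
      ultimately show ?thesis using l by simp
    qed
    then have "l dvd N" using min[of "N mod l"] l(1) by (auto simp: dvd_eq_mod_eq_0)
    then show "finite_dimensional (U_alg n r p)"
      using finite_dimensional_U[OF nz \<open>2 \<le> l\<close> l(2) min N(1) _ kN] by blast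
  }
qed

end
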